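(* Let $\Bbbk$ be a field, $V$ a finite set, $R=\Bbbk[V]$, and let $I\subseteq R$ be a nonzero proper squarefree monomial ideal that has an admissible regular sequence $a_1,\dots,a_d$ (so $d=d(I)$). Then the first linear strand of $I$ is supported on the relative simplicial complex $(X(I),Y(I))$; that is, the complex of free $R$-modules $\mathcal F_{(X(I),Y(I))}$, placed so that the faces of dimension $i+d-1$ span the term of homological degree $i$, is isomorphic to the first linear strand of the minimal free resolution of $I$.
   Context: Elements of $V$ are the variables of $R=\Bbbk[V]$; $R$ is $\mathbb Z^V$-graded. For $A\subseteq V$, $m_A=\prod_{v\in A}v$; $\operatorname{supp}(m)$ is the set of variables dividing a monomial $m$. The Alexander dual $I^A$ of a squarefree monomial ideal $I$ is generated by all monomials having a nontrivial common divisor with every monomial in $I$. $d(I)$ is the smallest degree of a minimal generator of $I$. An admissible regular sequence for $I$ is a sequence $a_1,\dots,a_d$ of squarefree monomials, $a_j\neq1$, pairwise coprime (equivalently, a regular sequence), with $d=d(I)$ and $a_1,\dots,a_d\in I^A$. Let $W=\bigcup_{j=1}^d\operatorname{supp}(a_j)$, let $C$ be the clutter on $V$ whose edges are the supports of the minimal generators of $I$, and let $C^c_{|W}$ be the $d$-partite $d$-uniform clutter with vertex set $W$ and edge set $\{\{v_1,\dots,v_d\}\mid v_j\in\operatorname{supp}(a_j)\ \forall j\}\setminus E(C)$. A subset $A\subseteq W$ is independent in $C^c_{|W}$ if it contains no edge of $C^c_{|W}$. $X(I)$ is the simplicial complex of all independent sets $A\subseteq W$ of $C^c_{|W}$. $Y(I)$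 is the subcomplex of those $A\in X(I)$ such that $\gcd(a_j,m_A)=1$ for some $j\in\{1,\dots,d\}$. (Both depend on the chosen admissible regular sequence.) For a simplicial complex $X$ with vertices among the variables of $R$ and a subcomplex $Y$, the relative simplicial complex $(X,Y)$ is the set of faces $X\setminus Y$. Its reduced relative chain complex over $\Bbbk$ is the cokernel of $\widetilde C_\bullet(Y)\otimes\Bbbk\to\widetilde C_\bullet(X)\otimes\Bbbk$. Labeling each face $F$ by the monomial $m_F$, the complex $\mathcal F_{(X,Y)}$ is obtained by replacing the basis element of each face $F\in X\setminus Y$ by a free generator $e_F$ of an $R$-module, of multidegree $F$, and replacing each matrix entry $\lambda_{F,G}\in\Bbbk$ of the relative chain complex (from $F$ to a facet $G$ of $F$) by $\lambda_{F,G}\,m_F/m_G$. First linear strand: let $F_\bullet$ be the minimal $\mathbb Z^V$-graded free resolution of $I$ (with $F_0\to I$ surjective), $F_i=\bigoplus_{\mathbf a}R(-\mathbf a)^{\beta_{i,\mathbf a}}$. The $r$-th linear strand is the complex with terms $\bigoplus_{|\mathbf a|=i+r}R(-\mathbf a)^{\beta_{i,\mathbf a}}$ in homological degree $i$ and the induced differentials; the first linear strand is the one with the smallest $r$ for which it is nonzero, i.e. $r=d(I)$. Isomorphism means isomorphism of complexes of $\mathbb Z^V$-graded $R$-modules. *)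

theory Defs
  imports Complex_Main "HOL-Library.Poly_Mapping" "HOL-Library.Multiset"
begin

section \<open>The polynomial ring and monomial ideals\<close>

text \<open>
  Monomials in the variables \<open>V\<close> are multisets over \<open>V\<close>, i.e. elements of the free commutative
  monoid on \<open>V\<close>, written additively: \<open>{#}\<close> is the monomial 1, divisibility is
  \<open>\<subseteq>#\<close>, the gcd is \<open>\<inter>#\<close>, the support is \<^const>\<open>set_mset\<close>, the degree is \<^const>\<open>size\<close>,
  and the squarefree monomial \<open>m\<^sub>A\<close> is \<^term>\<open>mset_set A\<close>. The polynomial ring \<open>\<k>[V]\<close> is the monoid
  algebra of this monoid.
\<close>

type_synonym ('v, 'k) mpoly = "'v multiset \<Rightarrow>\<^sub>0 'k"

definition mon :: "'v multiset \<Rightarrow> ('v, 'k::comm_ring_1) mpoly" where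
  "mon m = Poly_Mapping.single m 1"

lemma module_mult: "module ((*) :: 'a::comm_ring_1 \<Rightarrow> 'a \<Rightarrow> 'a)"
  by unfold_locales (simp_all add: algebra_simps)

abbreviation ideal_span :: "'a::comm_ring_1 set \<Rightarrow> 'a set" where
  "ideal_span \<equiv> module.span (*)"

definition squarefree_mon :: "'v multiset \<Rightarrow> bool" where
  "squarefree_mon m \<longleftrightarrow> (\<forall>v. count m v \<le> 1)"

definition squarefree_monomial_ideal :: "('v, 'k::comm_ring_1) mpoly set \<Rightarrow> bool" where
  "squarefree_monomial_ideal I \<longleftrightarrow> (\<exists>M. (\<forall>m\<in>M. squarefree_mon m) \<and> I = ideal_span (mon ` M))"

definition min_gens :: "('v, 'k::comm_ring_1) mpoly set \<Rightarrow> 'v multiset set" where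
  "min_gens I = {m. mon m \<in> I \<and> (\<forall>n. mon n \<in> I \<and> n \<subseteq># m \<longrightarrow> n = m)}"

definition initial_degree :: "('v, 'k::comm_ring_1) mpoly set \<Rightarrow> nat" where
  "initial_degree I = (LEAST n. \<exists>m\<in>min_gens I. n = size m)"

definition alexander_dual :: "('v, 'k::comm_ring_1) mpoly set \<Rightarrow> ('v, 'k) mpoly set" where
  "alexander_dual I = ideal_span (mon ` {m. \<forall>n. mon n \<in> I \<longrightarrow> m \<inter># n \<noteq> {#}})"

definition admissible_regular_sequence ::
    "('v, 'k::comm_ring_1) mpoly set \<Rightarrow> 'v multiset list \<Rightarrow> bool" where
  "admissible_regular_sequence I as \<longleftrightarrow>
     length as = initial_degree I \<and>
     (\<forall>a\<in>set as. squarefree_mon a \<and> a \<noteq> {#} \<and> mon a \<in> alexander_dual I) \<and>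
     (\<forall>i<length as. \<forall>j<length as. i \<noteq> j \<longrightarrow> as ! i \<inter># as ! j = {#})"

section \<open>The simplicial complexes \<open>X(I)\<close> and \<open>Y(I)\<close>\<close>

definition seq_support :: "'v multiset list \<Rightarrow> 'v set" where
  "seq_support as = (\<Union>a\<in>set as. set_mset a)"

definition clutter_edges :: "('v, 'k::comm_ring_1) mpoly set \<Rightarrow> 'v set set" where
  "clutter_edges I = set_mset ` min_gens I"

definition complement_edges ::
    "('v, 'k::comm_ring_1) mpoly set \<Rightarrow> 'v multiset list \<Rightarrow> 'v set set" where
  "complement_edges I as =
     {v ` {..<length as} | v. \<forall>j<length as. v j \<in># as ! j} - clutter_edges I"

definition X_complex ::
    "('v, 'k::comm_ring_1) mpoly set \<Rightarrow> 'v multiset list \<Rightarrow> 'v set set" where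
  "X_complex I as = {A. A \<subseteq> seq_support as \<and> (\<forall>e\<in>complement_edges I as. \<not> e \<subseteq> A)}"

definition Y_complex ::
    "('v, 'k::comm_ring_1) mpoly set \<Rightarrow> 'v multiset list \<Rightarrow> 'v set set" where
  "Y_complex I as = {A \<in> X_complex I as. \<exists>j<length as. as ! j \<inter># mset_set A = {#}}"

section \<open>Complexes of graded free modules\<close>

text \<open>
  The free \<open>R\<close>-module on a basis \<open>B\<close> consists of the finitely supported functions \<open>'b \<Rightarrow>\<^sub>0 R\<close> with
  support in \<open>B\<close>.
\<close>

definition smult :: "'r::comm_ring_1 \<Rightarrow> ('b \<Rightarrow>\<^sub>0 'r) \<Rightarrow> ('b \<Rightarrow>\<^sub>0 'r)" where
  "smult r f = Poly_Mapping.map ((*) r) f"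

lemma lookup_smult: "Poly_Mapping.lookup (smult r f) b = r * Poly_Mapping.lookup f b"
  by (simp add: smult_def Poly_Mapping.map.rep_eq when_def)

lemma module_smult: "module (smult :: 'r::comm_ring_1 \<Rightarrow> ('b \<Rightarrow>\<^sub>0 'r) \<Rightarrow> _)"
  by unfold_locales
    (auto intro!: poly_mapping_eqI simp: lookup_smult lookup_add algebra_simps)

definition free_module :: "'b set \<Rightarrow> ('b \<Rightarrow>\<^sub>0 'r::comm_ring_1) set" where
  "free_module B = {f. Poly_Mapping.keys f \<subseteq> B}"

definition lin_ext ::
    "('b \<Rightarrow> ('c \<Rightarrow>\<^sub>0 'r::comm_ring_1)) \<Rightarrow> ('b \<Rightarrow>\<^sub>0 'r) \<Rightarrow> ('c \<Rightarrow>\<^sub>0 'r)" where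
  "lin_ext D f = (\<Sum>b\<in>Poly_Mapping.keys f. smult (Poly_Mapping.lookup f b) (D b))"

definition restrict_to :: "'b set \<Rightarrow> ('b \<Rightarrow>\<^sub>0 'r::zero) \<Rightarrow> ('b \<Rightarrow>\<^sub>0 'r)" where
  "restrict_to B f = Poly_Mapping.mapp (\<lambda>b r. if b \<in> B then r else 0) f"

text \<open>
  A homologically \<open>\<int>\<close>-indexed family \<open>F\<^sub>i = \<Oplus>\<^bsub>b \<in> basis i\<^esub> R(- mdeg i b)\<close> of free
  \<open>\<int>\<^sup>V\<close>-graded modules; \<open>diff i b\<close> is the image in \<open>F\<^bsub>i-1\<^esub>\<close> of the basis element \<open>b\<close> of \<open>F\<^sub>i\<close>.
\<close>

record (overloaded) ('b, 'v, 'k::zero) free_complex =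
  basis :: "int \<Rightarrow> 'b set"
  mdeg :: "int \<Rightarrow> 'b \<Rightarrow> 'v \<Rightarrow> int"
  diff :: "int \<Rightarrow> 'b \<Rightarrow> ('b \<Rightarrow>\<^sub>0 ('v multiset \<Rightarrow>\<^sub>0 'k))"

definition homogeneous_poly :: "('v \<Rightarrow> int) \<Rightarrow> ('v, 'k::comm_ring_1) mpoly \<Rightarrow> bool" where
  "homogeneous_poly c p \<longleftrightarrow> (\<forall>m\<in>Poly_Mapping.keys p. \<forall>v. int (count m v) = c v)"

definition chain_module ::
    "('b, 'v, 'k::comm_ring_1) free_complex \<Rightarrow> int \<Rightarrow> ('b \<Rightarrow>\<^sub>0 ('v, 'k) mpoly) set" where
  "chain_module F i = free_module (basis F i)"

text \<open>The component of \<open>F\<^sub>i\<close> of multidegree \<open>c\<close>.\<close>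

definition graded_part ::
    "('b, 'v, 'k::comm_ring_1) free_complex \<Rightarrow> int \<Rightarrow> ('v \<Rightarrow> int) \<Rightarrow> ('b \<Rightarrow>\<^sub>0 ('v, 'k) mpoly) set" where
  "graded_part F i c =
     {f \<in> chain_module F i.
        \<forall>b\<in>basis F i. homogeneous_poly (\<lambda>v. c v - mdeg F i b v) (Poly_Mapping.lookup f b)}"

definition boundary ::
    "('b, 'v, 'k::comm_ring_1) free_complex \<Rightarrow> int \<Rightarrow>
     ('b \<Rightarrow>\<^sub>0 ('v, 'k) mpoly) \<Rightarrow> ('b \<Rightarrow>\<^sub>0 ('v, 'k) mpoly)" where
  "boundary F i = lin_ext (diff F i)"

definition graded_free_complex :: "('b, 'v, 'k::comm_ring_1) free_complex \<Rightarrow> bool" where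
  "graded_free_complex F \<longleftrightarrow>
     (\<forall>i. \<forall>b\<in>basis F i. diff F i b \<in> graded_part F (i - 1) (mdeg F i b)) \<and>
     (\<forall>i. \<forall>f\<in>chain_module F i. boundary F (i - 1) (boundary F i f) = 0)"

definition augmentation ::
    "('b \<Rightarrow> ('v, 'k::comm_ring_1) mpoly) \<Rightarrow> ('b \<Rightarrow>\<^sub>0 ('v, 'k) mpoly) \<Rightarrow> ('v, 'k) mpoly" where
  "augmentation \<epsilon> f = (\<Sum>b\<in>Poly_Mapping.keys f. Poly_Mapping.lookup f b * \<epsilon> b)"

definition irrelevant_ideal :: "('v, 'k::comm_ring_1) mpoly set" where
  "irrelevant_ideal = ideal_span (range (\<lambda>v. mon {#v#}))"

text \<open>
  A resolution of the ideal \<open>I\<close> itself (not of \<open>R/I\<close>): the augmentation, with \<open>\<epsilon>\<close> giving the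
  images of the basis elements of \<open>F\<^sub>0\<close>, maps \<open>F\<^sub>0\<close> onto \<open>I\<close>. Minimality is the condition
  \<open>\<partial>(F\<^sub>i) \<subseteq> \<mm> F\<^bsub>i-1\<^esub>\<close>.
\<close>

definition minimal_free_resolution ::
    "('v, 'k::comm_ring_1) mpoly set \<Rightarrow> ('b, 'v, 'k) free_complex \<Rightarrow>
     ('b \<Rightarrow> ('v, 'k) mpoly) \<Rightarrow> bool" where
  "minimal_free_resolution I F \<epsilon> \<longleftrightarrow>
     graded_free_complex F \<and>
     (\<forall>i. finite (basis F i)) \<and>
     (\<forall>i<0. basis F i = {}) \<and>
     (\<forall>b\<in>basis F 0. homogeneous_poly (mdeg F 0 b) (\<epsilon> b)) \<and>
     augmentation \<epsilon> ` chain_module F 0 = I \<and>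
     {f \<in> chain_module F 0. augmentation \<epsilon> f = 0} = boundary F 1 ` chain_module F 1 \<and>
     (\<forall>i\<ge>1. {f \<in> chain_module F i. boundary F i f = 0} =
            boundary F (i + 1) ` chain_module F (i + 1)) \<and>
     (\<forall>i. \<forall>b\<in>basis F i. \<forall>c. Poly_Mapping.lookup (diff F i b) c \<in> irrelevant_ideal)"

text \<open>
  The differential of a linear strand is the one induced by \<open>F\<close>: restrict it to the summand spanned
  by the basis elements of total degree \<open>i + r\<close> and project onto the corresponding summand of
  \<open>F\<^bsub>i-1\<^esub>\<close>.
\<close>

definition strand_basis :: "int \<Rightarrow> ('b, 'v::finite, 'k::zero) free_complex \<Rightarrow> int \<Rightarrow> 'b set" where
  "strand_basis r F i = {b \<in> basis F i. (\<Sum>v\<in>UNIV. mdeg F i b v) = i + r}"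

definition linear_strand ::
    "int \<Rightarrow> ('b, 'v::finite, 'k::comm_ring_1) free_complex \<Rightarrow> ('b, 'v, 'k) free_complex" where
  "linear_strand r F =
     \<lparr>basis = strand_basis r F,
      mdeg = mdeg F,
      diff = (\<lambda>i b. restrict_to (strand_basis r F (i - 1)) (diff F i b))\<rparr>"

definition first_linear_strand ::
    "('b, 'v::finite, 'k::comm_ring_1) free_complex \<Rightarrow> ('b, 'v, 'k) free_complex" where
  "first_linear_strand F =
     linear_strand (LEAST r. \<exists>i. basis (linear_strand r F) i \<noteq> {}) F"

definition complex_isomorphic ::
    "('b, 'v, 'k::comm_ring_1) free_complex \<Rightarrow> ('c, 'v, 'k) free_complex \<Rightarrow> bool" where
  "complex_isomorphic F G \<longleftrightarrow>
     (\<exists>\<phi> :: int \<Rightarrow> ('b \<Rightarrow>\<^sub>0 ('v, 'k) mpoly) \<Rightarrow> ('c \<Rightarrow>\<^sub>0 ('v, 'k) mpoly). \<forall>i.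
        module_hom smult smult (\<phi> i) \<and>
        bij_betw (\<phi> i) (chain_module F i) (chain_module G i) \<and>
        (\<forall>c. \<phi> i ` graded_part F i c = graded_part G i c) \<and>
        (\<forall>f\<in>chain_module F i. \<phi> (i - 1) (boundary F i f) = boundary G i (\<phi> i f)))"

section \<open>The complex \<open>\<F>\<^bsub>(X,Y)\<^esub>\<close> of a relative simplicial complex\<close>

text \<open>
  The entry \<open>\<lambda>\<^bsub>F,G\<^esub>\<close> of the simplicial boundary map for the orientation of faces given by an
  injective numbering \<open>pos\<close> of the vertices; the sum has at most one term, and none if \<open>G\<close> is not
  a facet of \<open>F\<close>.
\<close>

definition incidence :: "('v \<Rightarrow> nat) \<Rightarrow> 'v set \<Rightarrow> 'v set \<Rightarrow> int" where
  "incidence pos F G = (\<Sum>v | v \<in> F \<and> G = F - {v}. (-1) ^ card {u \<in> F. pos u < pos v})"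

text \<open>
  The faces of dimension \<open>i + s\<close> span the term of homological degree \<open>i\<close>. The empty face, of
  dimension \<open>-1\<close>, is included (reduced chain complex).
\<close>

definition relative_free_complex ::
    "('v \<Rightarrow> nat) \<Rightarrow> int \<Rightarrow> 'v set set \<Rightarrow> 'v set set \<Rightarrow> ('v set, 'v::finite, 'k::comm_ring_1) free_complex" where
  "relative_free_complex pos s X Y =
     \<lparr>basis = (\<lambda>i. {F \<in> X - Y. int (card F) - 1 = i + s}),
      mdeg = (\<lambda>i F v. int (count (mset_set F) v)),
      diff = (\<lambda>i F. \<Sum>G\<in>X - Y. Poly_Mapping.single G
                (Poly_Mapping.single (mset_set F - mset_set G) (of_int (incidence pos F G))))\<rparr>"

end

theory Submission
  imports Defs
begin

text \<open>
  The linear strand of a minimal free resolution \<open>F\<close> of \<open>I\<close> is determined recursively by \<open>I\<close>: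
  in total degree \<open>i + d\<close> minimality and exactness identify \<open>F\<^sub>i\<close> with the cycles of the strand in
  homological degree \<open>i - 1\<close>, and \<open>F\<^sub>0\<close> with the degree \<open>d\<close> part of \<open>I\<close>. A complex of free modules
  generated in these degrees and with the same property is therefore isomorphic to the strand.
  The faces of \<open>X(I)\<close> outside \<open>Y(I)\<close> are the sets \<open>A\<close> meeting every \<open>a\<^sub>j\<close> all of whose transversals
  are generators of \<open>I\<close>. A cycle in \<open>\<F>\<^bsub>(X,Y)\<^esub>\<close> of a multidegree one above the strand vanishes unless
  the multidegree is squarefree, say with support \<open>C\<close>; then up to sign its coefficients at any
  two facets \<open>C - {u}\<close>, \<open>C - {v}\<close> with \<open>C - {u, v}\<close> in \<open>X \<setminus> Y\<close> agree, and connecting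
  facets through such pairs shows that \<open>C\<close> itself is a face and the cycle a multiple of its boundary.
\<close>

section \<open>Free modules\<close>

text \<open>Neither side comes with a map to the other: the resolution is arbitrary and its basis
  has no names. Hence both are compared with common data, bijections onto pieces of \<open>I\<close>
  and onto cycles, and the isomorphism arises by lifting basis elements. One total degree per
  homological degree suffices, since all generators of the \<open>i\<close>-th term have degree
  \<open>i + d\<close>.

  The relation between the coefficients at \<open>C - {u}\<close> and \<open>C - {v}\<close> is read
  off the boundary coordinate at \<open>C - {u, v}\<close>. For \<open>i = 0\<close> this is
  impossible: \<open>C\<close> has \<open>d + 1\<close> elements, and \<open>C - {u, v}\<close> is
  too small to meet all \<open>a_j\<close>. The augmentation takes over. It needs a sign on
  \<open>m_A\<close>, because the simplicial signs come from a numbering of all variables that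
  ignores the supports of the \<open>a_j\<close>.

  Admissibility enters by counting: every monomial of \<open>I\<close> meets \<open>d\<close>
  disjoint supports, so one of degree \<open>d\<close> has exactly one variable in each. Thus the
  faces with \<open>d\<close> vertices account for the degree \<open>d\<close> part of
  \<open>I\<close>.\<close>

abbreviation lookup where "lookup \<equiv> Poly_Mapping.lookup"
abbreviation keys where "keys \<equiv> Poly_Mapping.keys"
abbreviation single where "single \<equiv> Poly_Mapping.single"

lemma smult_single [simp]: "smult r (single b s) = single b (r * s)"
  by (rule poly_mapping_eqI) (simp add: lookup_smult lookup_single when_def)

lemma single_in_free_module [simp]: "b \<in> B \<Longrightarrow> single b r \<in> free_module B"
  by (simp add: free_module_def)

lemma free_module_add: "f \<in> free_module B \<Longrightarrow> g \<in> free_module B \<Longrightarrow> f + g \<in> free_module B"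
  using Poly_Mapping.keys_add[of f g] by (auto simp: free_module_def)

lemma free_module_smult: "f \<in> free_module B \<Longrightarrow> smult r f \<in> free_module B"
  by (auto simp: free_module_def in_keys_iff lookup_smult subset_iff)
    (metis mult_zero_right)

lemma free_module_iff: "f \<in> free_module B \<longleftrightarrow> (\<forall>b. b \<notin> B \<longrightarrow> lookup f b = 0)"
  by (auto simp: free_module_def in_keys_iff)

lemma free_module_0 [simp]: "0 \<in> free_module B"
  by (simp add: free_module_iff)

lemma free_module_empty: "free_module {} = {0}"
  by (auto simp: free_module_def)

lemma poly_mapping_sum_single: "(\<Sum>b\<in>keys f. single b (lookup f b)) = f"
  by (rule poly_mapping_eqI) (simp add: lookup_sum lookup_single when_def in_keys_iff)

lemma poly_mapping_induct_single [case_names zero single add]: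
  assumes "P 0" and "\<And>b r. P (single b r)" and "\<And>f g. P f \<Longrightarrow> P g \<Longrightarrow> P (f + g)"
  shows "P (f :: 'b \<Rightarrow>\<^sub>0 'r::comm_monoid_add)"
proof -
  have "P (\<Sum>b\<in>A. single b (lookup f b))" if "finite A" for A
    using that by induction (auto intro: assms)
  then have "P (\<Sum>b\<in>keys f. single b (lookup f b))"
    by simp
  then show ?thesis
    by (simp add: poly_mapping_sum_single)
qed

lemma free_module_induct [consumes 1, case_names zero single add]:
  assumes "f \<in> free_module B"
    and "P 0" and "\<And>b r. b \<in> B \<Longrightarrow> P (single b r)"
    and "\<And>f g. f \<in> free_module B \<Longrightarrow> g \<in> free_module B \<Longrightarrow> P f \<Longrightarrow> P g \<Longrightarrow> P (f + g)"
  shows "P (f :: 'b \<Rightarrow>\<^sub>0 'r::comm_ring_1)"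
proof -
  have "A \<subseteq> B \<longrightarrow> P (\<Sum>b\<in>A. single b (lookup f b)) \<and>
      (\<Sum>b\<in>A. single b (lookup f b)) \<in> free_module B" if "finite A" for A
    using that by induction (auto intro: assms free_module_add)
  then have "P (\<Sum>b\<in>keys f. single b (lookup f b))"
    using assms(1) by (simp add: free_module_def)
  then show ?thesis
    by (simp add: poly_mapping_sum_single)
qed

text \<open>\<open>lin_ext\<close> and \<open>augmentation\<close> differ only in the scalar action
  on the target; with the action \<open>s\<close> as a parameter their linearity is proved
  once.\<close>

definition extend :: "('r::comm_ring_1 \<Rightarrow> 'm::ab_group_add \<Rightarrow> 'm) \<Rightarrow> ('b \<Rightarrow> 'm) \<Rightarrow> ('b \<Rightarrow>\<^sub>0 'r) \<Rightarrow> 'm"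
  where "extend s D f = (\<Sum>b\<in>keys f. s (lookup f b) (D b))"

lemma lin_ext_eq_extend: "lin_ext = extend smult"
  by (simp add: fun_eq_iff lin_ext_def extend_def)

lemma augmentation_eq_extend: "augmentation = extend (*)"
  by (simp add: fun_eq_iff augmentation_def extend_def)

context module
begin

lemma extend_superset:
  assumes "finite A" "keys f \<subseteq> A"
  shows "extend scale D f = (\<Sum>b\<in>A. lookup f b *s D b)"
  unfolding extend_def using assms
  by (intro sum.mono_neutral_left) (auto simp: in_keys_iff)

lemma extend_single [simp]: "extend scale D (single b r) = r *s D b"
  by (subst extend_superset[of "{b}"]) auto

lemma module_hom_extend: "module_hom smult scale (extend scale (D :: 'e \<Rightarrow> 'b))"
proof -
  interpret S: module "smult :: 'a \<Rightarrow> ('e \<Rightarrow>\<^sub>0 'a) \<Rightarrow> _"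
    by (rule module_smult)
  show ?thesis
  proof unfold_locales
    fix f g :: "'e \<Rightarrow>\<^sub>0 'a"
    have "keys (f + g) \<subseteq> keys f \<union> keys g"
      by (rule Poly_Mapping.keys_add)
    then show "extend scale D (f + g) = extend scale D f + extend scale D g"
      by (simp add: extend_superset[of "keys f \<union> keys g"] lookup_add scale_left_distrib
          sum.distrib)
  next
    fix r and f :: "'e \<Rightarrow>\<^sub>0 'a"
    have "keys (smult r f) \<subseteq> keys f"
      using free_module_smult[of f "keys f" r] by (simp add: free_module_def)
    then show "extend scale D (smult r f) = r *s extend scale D f"
      by (simp add: extend_superset[of "keys f"] lookup_smult scale_sum_right)
  qed
qed

end

lemma lin_ext_hom: "module_hom smult smult (lin_ext D)"
  unfolding lin_ext_eq_extend by (rule module.module_hom_extend[OF module_smult])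

lemma augmentation_hom: "module_hom smult (*) (augmentation e)"
  unfolding augmentation_eq_extend by (rule module.module_hom_extend[OF module_mult])

lemma lin_ext_single [simp]: "lin_ext D (single b r) = smult r (D b)"
  by (simp add: lin_ext_eq_extend module.extend_single[OF module_smult])

lemma augmentation_single [simp]: "augmentation e (single b r) = r * e b"
  by (simp add: augmentation_eq_extend module.extend_single[OF module_mult])

lemmas lin_ext_add = module_hom.add[OF lin_ext_hom]
lemmas lin_ext_0 = module_hom.zero[OF lin_ext_hom]
lemmas augmentation_add = module_hom.add[OF augmentation_hom]
lemmas augmentation_0 = module_hom.zero[OF augmentation_hom]

lemma module_hom_eq_on_free_module:
  assumes "module_hom smult s g" "module_hom smult s h"
    and "\<And>b. b \<in> B \<Longrightarrow> g (single b 1) = h (single b 1)" and "f \<in> free_module B"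
  shows "g f = h f"
proof -
  interpret g: module_hom smult s g by fact
  interpret h: module_hom smult s h by fact
  show ?thesis
    using assms(4)
  proof (induction rule: free_module_induct)
    case (single b r)
    have "single b r = smult r (single b 1)"
      by simp
    then show ?case
      using single assms(3) by (metis g.scale h.scale)
  qed (auto simp: g.add h.add)
qed

lemma lin_ext_in_free_module:
  assumes "\<And>b. b \<in> B \<Longrightarrow> D b \<in> free_module B'" and "f \<in> free_module B"
  shows "lin_ext D f \<in> free_module B'"
  using assms(2)
  by (induction rule: free_module_induct)
    (auto simp: lin_ext_0 lin_ext_add intro: free_module_add free_module_smult assms(1))

lemma lin_ext_cong:
  assumes "\<And>b. b \<in> B \<Longrightarrow> D b = D' b" "f \<in> free_module B"
  shows "lin_ext D f = lin_ext D' f"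
  using assms by (auto simp: lin_ext_def free_module_def intro!: sum.cong)

text \<open>Each coordinate of a \<open>lin_ext\<close> is an \<open>augmentation\<close>, so
  multigraded facts are proved for the latter and transferred coordinate by coordinate.\<close>

lemma lookup_lin_ext: "lookup (lin_ext D f) c = augmentation (\<lambda>b. lookup (D b) c) f"
  by (simp add: lin_ext_def augmentation_def lookup_sum lookup_smult)

section \<open>Multigraded pieces\<close>

lemma homogeneous_poly_0 [simp]: "homogeneous_poly c 0"
  by (simp add: homogeneous_poly_def)

text \<open>A multidegree determines its monomial, so each multigraded piece of the ring consists of
  the scalar multiples of at most one monomial.\<close>

lemma homogeneous_poly_cases:
  assumes "homogeneous_poly c p"
  obtains "p = 0"
  | m k where "k \<noteq> 0" "p = single m k" "\<And>v. int (count m v) = c v"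
proof (cases "p = 0")
  case False
  then obtain m where m: "m \<in> keys p"
    by fastforce
  have "m' = m" if "m' \<in> keys p" for m'
    using assms m that by (auto simp: homogeneous_poly_def intro!: multiset_eqI)
      (metis of_nat_eq_iff)
  then have "keys p = {m}"
    using m by blast
  then have "p = single m (lookup p m)"
    using poly_mapping_sum_single[of p] by simp
  moreover have "lookup p m \<noteq> 0"
    using m by (simp add: in_keys_iff)
  ultimately show ?thesis
    using that(2) assms m by (auto simp: homogeneous_poly_def)
qed (use that in auto)

lemma homogeneous_poly_single:
  "(\<And>v. int (count m v) = c v) \<Longrightarrow> homogeneous_poly c (single m k)"
  by (auto simp: homogeneous_poly_def)

lemma homogeneous_poly_add:
  "homogeneous_poly c p \<Longrightarrow> homogeneous_poly c q \<Longrightarrow> homogeneous_poly c (p + q)"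
  using Poly_Mapping.keys_add[of p q] by (auto simp: homogeneous_poly_def)

lemma homogeneous_poly_mult:
  assumes "homogeneous_poly a p" "homogeneous_poly b q" "\<And>v. c v = a v + b v"
  shows "homogeneous_poly c (p * q)"
proof -
  have "\<exists>m n. x = m + n \<and> m \<in> keys p \<and> n \<in> keys q" if "x \<in> keys (p * q)" for x
    using keys_mult[of p q] that by blast
  then show ?thesis
    using assms unfolding homogeneous_poly_def by fastforce
qed

definition homogeneous_part :: "('v \<Rightarrow> int) \<Rightarrow> ('v, 'k::comm_ring_1) mpoly \<Rightarrow> ('v, 'k) mpoly" where
  "homogeneous_part c p = Poly_Mapping.mapp (\<lambda>m r. if \<forall>v. int (count m v) = c v then r else 0) p"

lemma lookup_homogeneous_part:
  "lookup (homogeneous_part c p) m = (if \<forall>v. int (count m v) = c v then lookup p m else 0)"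
  by (simp add: homogeneous_part_def lookup_mapp when_def in_keys_iff)

lemma homogeneous_part_0 [simp]: "homogeneous_part c 0 = 0"
  by (rule poly_mapping_eqI) (simp add: lookup_homogeneous_part)

lemma homogeneous_part_add:
  "homogeneous_part c (p + q) = homogeneous_part c p + homogeneous_part c q"
  by (rule poly_mapping_eqI) (simp add: lookup_homogeneous_part lookup_add)

lemma homogeneous_part_homogeneous [simp]: "homogeneous_poly c (homogeneous_part c p)"
  by (auto simp: homogeneous_poly_def in_keys_iff lookup_homogeneous_part split: if_splits)

lemma homogeneous_part_eq: "homogeneous_poly c p \<Longrightarrow> homogeneous_part c p = p"
  by (rule poly_mapping_eqI)
    (auto simp: lookup_homogeneous_part homogeneous_poly_def in_keys_iff)

lemma homogeneous_part_single:
  "homogeneous_part c (single m k) = (if \<forall>v. int (count m v) = c v then single m k else 0)"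
  by (rule poly_mapping_eqI) (auto simp: lookup_homogeneous_part lookup_single when_def)

text \<open>By homogeneity \<open>q\<close> is a scalar times one monomial, and multiplication by a
  monomial translates all multidegrees by the same amount.\<close>

lemma homogeneous_part_mult:
  assumes "homogeneous_poly e q" and c: "\<And>v. c v = a v + e v"
  shows "homogeneous_part c (p * q) = homogeneous_part a p * q"
  using assms(1)
proof (cases rule: homogeneous_poly_cases)
  case (2 n k)
  have e: "e = (\<lambda>v. int (count n v))"
    using 2 by auto
  show ?thesis
  proof (induction p rule: poly_mapping_induct_single)
    case (single m r)
    then show ?case
      unfolding 2 mult_single homogeneous_part_single
      by (simp add: c e when_def homogeneous_part_single mult_single)
  qed (auto simp: homogeneous_part_add algebra_simps)
qed simp

text \<open>\<open>graded_part\<close> for a single free module with its own degree function, so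
  that graded maps can be studied without a surrounding complex.\<close>

definition graded_piece ::
    "'b set \<Rightarrow> ('b \<Rightarrow> 'v \<Rightarrow> int) \<Rightarrow> ('v \<Rightarrow> int) \<Rightarrow> ('b \<Rightarrow>\<^sub>0 ('v, 'k::comm_ring_1) mpoly) set" where
  "graded_piece B md c = {f \<in> free_module B. \<forall>b\<in>B. homogeneous_poly (\<lambda>v. c v - md b v) (lookup f b)}"

lemma graded_part_eq: "graded_part F i c = graded_piece (basis F i) (mdeg F i) c"
  by (simp add: graded_part_def graded_piece_def chain_module_def)

lemma graded_piece_homogeneous:
  "f \<in> graded_piece B md c \<Longrightarrow> homogeneous_poly (\<lambda>v. c v - md b v) (lookup f b)"
  by (cases "b \<in> B") (auto simp: graded_piece_def free_module_iff)

lemma graded_piece_free: "f \<in> graded_piece B md c \<Longrightarrow> f \<in> free_module B"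
  by (simp add: graded_piece_def)

lemma graded_piece_0 [simp]: "0 \<in> graded_piece B md c"
  by (simp add: graded_piece_def)

lemma graded_piece_add:
  "f \<in> graded_piece B md c \<Longrightarrow> g \<in> graded_piece B md c \<Longrightarrow> f + g \<in> graded_piece B md c"
  by (auto simp: graded_piece_def lookup_add intro: free_module_add homogeneous_poly_add)

lemma graded_piece_sum:
  "(\<And>a. a \<in> A \<Longrightarrow> h a \<in> graded_piece B md c) \<Longrightarrow> sum h A \<in> graded_piece B md c"
  by (induction A rule: infinite_finite_induct) (auto intro: graded_piece_add)

lemma graded_piece_uminus:
  "f \<in> graded_piece B md c \<Longrightarrow> - f \<in> graded_piece B md c"
  by (auto simp: graded_piece_def free_module_def homogeneous_poly_def keys_minus)

lemma graded_piece_diff: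
  "f \<in> graded_piece B md c \<Longrightarrow> g \<in> graded_piece B md c \<Longrightarrow> f - g \<in> graded_piece B md c"
  using graded_piece_add[OF _ graded_piece_uminus, of f B md c g] by simp

lemma graded_part_diff: "f \<in> graded_part F i c \<Longrightarrow> g \<in> graded_part F i c \<Longrightarrow> f - g \<in> graded_part F i c"
  unfolding graded_part_eq by (rule graded_piece_diff)

lemma single_in_graded_piece [simp]: "b \<in> B \<Longrightarrow> single b 1 \<in> graded_piece B md (md b)"
  by (auto simp: graded_piece_def lookup_single when_def homogeneous_poly_def)

lemma lin_ext_in_graded_piece:
  assumes "\<And>b. b \<in> B \<Longrightarrow> D b \<in> graded_piece B' md' (md b)" and "f \<in> graded_piece B md c"
  shows "lin_ext D f \<in> graded_piece B' md' c"
proof -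
  have "smult (lookup f b) (D b) \<in> graded_piece B' md' c" if "b \<in> keys f" for b
  proof -
    have b: "b \<in> B"
      using that assms(2) by (auto simp: graded_piece_def free_module_def)
    show ?thesis
      unfolding graded_piece_def
      using assms(1)[OF b] graded_piece_homogeneous[OF assms(2), of b]
      by (auto simp: lookup_smult graded_piece_def intro!: free_module_smult
          intro: homogeneous_poly_mult)
  qed
  then have "(\<Sum>b\<in>keys f. smult (lookup f b) (D b)) \<in> graded_piece B' md' c"
    by (rule graded_piece_sum)
  then show ?thesis
    by (simp add: lin_ext_def)
qed

text \<open>The projection onto multidegree \<open>c\<close>. Applied to an arbitrary preimage of a
  homogeneous element under a graded map, it yields a preimage of the same multidegree.\<close>

definition graded_comp ::
    "('b \<Rightarrow> 'v \<Rightarrow> int) \<Rightarrow> ('v \<Rightarrow> int) \<Rightarrow> ('b \<Rightarrow>\<^sub>0 ('v, 'k::comm_ring_1) mpoly) \<Rightarrow> ('b \<Rightarrow>\<^sub>0 ('v, 'k) mpoly)"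
  where "graded_comp md c f = Poly_Mapping.mapp (\<lambda>b. homogeneous_part (\<lambda>v. c v - md b v)) f"

lemma lookup_graded_comp:
  "lookup (graded_comp md c f) b = homogeneous_part (\<lambda>v. c v - md b v) (lookup f b)"
  by (auto simp: graded_comp_def lookup_mapp when_def in_keys_iff)

lemma graded_comp_in_graded_piece: "f \<in> free_module B \<Longrightarrow> graded_comp md c f \<in> graded_piece B md c"
  by (auto simp: graded_piece_def free_module_iff lookup_graded_comp)

lemma graded_comp_eq: "f \<in> graded_piece B md c \<Longrightarrow> graded_comp md c f = f"
  by (rule poly_mapping_eqI)
    (simp add: lookup_graded_comp homogeneous_part_eq[OF graded_piece_homogeneous])

lemma graded_comp_0 [simp]: "graded_comp md c 0 = 0"
  by (rule poly_mapping_eqI) (simp add: lookup_graded_comp)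

lemma graded_comp_add: "graded_comp md c (f + g) = graded_comp md c f + graded_comp md c g"
  by (rule poly_mapping_eqI) (simp add: lookup_graded_comp lookup_add homogeneous_part_add)

lemma graded_comp_single:
  "graded_comp md c (single b p) = single b (homogeneous_part (\<lambda>v. c v - md b v) p)"
  by (rule poly_mapping_eqI) (auto simp: lookup_graded_comp lookup_single when_def)

text \<open>The offset \<open>a\<close> makes the target the shifted ring \<open>R(-a)\<close>:
  \<open>a = 0\<close> serves the augmentation onto the ideal, \<open>a = md' b'\<close> the
  coordinate at \<open>b'\<close> of a map of free modules.\<close>

lemma homogeneous_part_augmentation:
  assumes "\<And>b. b \<in> B \<Longrightarrow> homogeneous_poly (\<lambda>v. md b v - a v) (\<epsilon> b)" and "f \<in> free_module B"
  shows "homogeneous_part (\<lambda>v. c v - a v) (augmentation \<epsilon> f) = augmentation \<epsilon> (graded_comp md c f)"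
  using assms(2)
proof (induction rule: free_module_induct)
  case zero
  show ?case
    by (simp add: augmentation_0)
next
  case (single b p)
  then show ?case
    by (simp add: graded_comp_single homogeneous_part_mult[OF assms(1)])
qed (simp add: graded_comp_add augmentation_add homogeneous_part_add)

lemma graded_comp_lin_ext:
  assumes "\<And>b. b \<in> B \<Longrightarrow> D b \<in> graded_piece B' md' (md b)" and "f \<in> free_module B"
  shows "graded_comp md' c (lin_ext D f) = lin_ext D (graded_comp md c f)"
proof (rule poly_mapping_eqI)
  fix b'
  show "lookup (graded_comp md' c (lin_ext D f)) b' = lookup (lin_ext D (graded_comp md c f)) b'"
    unfolding lookup_graded_comp lookup_lin_ext
    by (rule homogeneous_part_augmentation[OF graded_piece_homogeneous[OF assms(1)] assms(2)])
qed

section \<open>Lifting through bijections in one total degree\<close>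

lemma free_module_lift_aux:
  fixes E :: "('b \<Rightarrow>\<^sub>0 ('v::finite, 'k::comm_ring_1) mpoly) \<Rightarrow> 'n::ab_group_add"
    and E' :: "('c \<Rightarrow>\<^sub>0 ('v, 'k) mpoly) \<Rightarrow> 'n"
  assumes E: "module_hom smult s E" and E': "module_hom smult s E'"
    and deg: "\<And>b. b \<in> B \<Longrightarrow> sum (md b) UNIV = n"
    and bij: "\<And>c. sum c UNIV = n \<Longrightarrow> bij_betw E (graded_piece B md c) (K c)"
    and bij': "\<And>c. sum c UNIV = n \<Longrightarrow> bij_betw E' (graded_piece B' md' c) (K c)"
  obtains D where "\<And>b. b \<in> B \<Longrightarrow> D b \<in> graded_piece B' md' (md b)"
    and "\<And>f. f \<in> free_module B \<Longrightarrow> E' (lin_ext D f) = E f"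
proof -
  \<comment> \<open>The multidegree \<open>md b\<close> of a basis element has total degree
    \<open>n\<close>, where \<open>E\<close> and \<open>E'\<close> have the same image
    \<open>K (md b)\<close>; so the value of \<open>E\<close> at \<open>b\<close> lifts through
    \<open>E'\<close>.\<close>
  have "\<forall>b\<in>B. \<exists>y\<in>graded_piece B' md' (md b). E' y = E (single b 1)"
  proof
    fix b assume b: "b \<in> B"
    have "E (single b 1) \<in> K (md b)"
      using bij_betwE[OF bij[OF deg[OF b]]] b by simp
    then show "\<exists>y\<in>graded_piece B' md' (md b). E' y = E (single b 1)"
      using bij_betw_imp_surj_on[OF bij'[OF deg[OF b]]] by (metis (no_types, lifting) imageE)
  qed
  then obtain D where D: "\<And>b. b \<in> B \<Longrightarrow> D b \<in> graded_piece B' md' (md b)"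
    and ED: "\<And>b. b \<in> B \<Longrightarrow> E' (D b) = E (single b 1)"
    by metis
  have hom: "module_hom smult s (E' \<circ> lin_ext D)"
    by (rule module_hom_compose[OF lin_ext_hom E'])
  have "E' (lin_ext D f) = E f" if "f \<in> free_module B" for f
  proof -
    have "(E' \<circ> lin_ext D) (single b 1) = E (single b 1)" if "b \<in> B" for b
      using ED[OF that] by (simp add: module.scale_one[OF module_smult])
    then show ?thesis
      using module_hom_eq_on_free_module[OF hom E _ that] by simp
  qed
  then show ?thesis
    using that D by blast
qed

text \<open>The composite preserves multidegrees and does not change the value of \<open>E\<close>;
  as \<open>E\<close> is injective in the degrees of the basis elements, the composite fixes each of
  them.\<close>

lemma free_module_lift_inverse:
  fixes E :: "('b \<Rightarrow>\<^sub>0 ('v::finite, 'k::comm_ring_1) mpoly) \<Rightarrow> 'n::ab_group_add"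
    and E' :: "('c \<Rightarrow>\<^sub>0 ('v, 'k) mpoly) \<Rightarrow> 'n"
  assumes deg: "\<And>b. b \<in> B \<Longrightarrow> sum (md b) UNIV = n"
    and bij: "\<And>c. sum c UNIV = n \<Longrightarrow> bij_betw E (graded_piece B md c) (K c)"
    and D: "\<And>b. b \<in> B \<Longrightarrow> D b \<in> graded_piece B' md' (md b)"
    and ED: "\<And>f. f \<in> free_module B \<Longrightarrow> E' (lin_ext D f) = E f"
    and D': "\<And>b. b \<in> B' \<Longrightarrow> D' b \<in> graded_piece B md (md' b)"
    and ED': "\<And>f. f \<in> free_module B' \<Longrightarrow> E (lin_ext D' f) = E' f"
    and f: "f \<in> free_module B"
  shows "lin_ext D' (lin_ext D f) = f"
proof -
  have "lin_ext D' (lin_ext D (single b 1)) = single b 1" if b: "b \<in> B" for b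
  proof -
    have b1: "single b 1 \<in> graded_piece B md (md b)"
      using b by simp
    have Db: "lin_ext D (single b 1) \<in> graded_piece B' md' (md b)"
      by (rule lin_ext_in_graded_piece[OF D b1])
    have DDb: "lin_ext D' (lin_ext D (single b 1)) \<in> graded_piece B md (md b)"
      by (rule lin_ext_in_graded_piece[OF D' Db])
    have "E (lin_ext D' (lin_ext D (single b 1))) = E (single b 1)"
      using ED'[OF graded_piece_free[OF Db]] ED[OF graded_piece_free[OF b1]] by simp
    then show ?thesis
      using inj_onD[OF bij_betw_imp_inj_on[OF bij[OF deg[OF b]]] _ DDb b1] by blast
  qed
  moreover have "module_hom smult smult (\<lambda>f :: 'b \<Rightarrow>\<^sub>0 ('v, 'k) mpoly. f)"
    by (rule module.module_hom_ident[OF module_smult])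
  moreover have "module_hom smult smult (lin_ext D' \<circ> lin_ext D)"
    by (rule module_hom_compose[OF lin_ext_hom lin_ext_hom])
  ultimately have "(lin_ext D' \<circ> lin_ext D) f = f"
    using module_hom_eq_on_free_module[where g = "lin_ext D' \<circ> lin_ext D" and h = "\<lambda>f. f" and B = B] f
    unfolding o_def by blast
  then show ?thesis
    by simp
qed

text \<open>A graded free module generated in one total degree is determined by its pieces there. So
  bijectivity of \<open>E\<close> and \<open>E'\<close> in total degree \<open>n\<close> makes the
  lifts in the two directions mutually inverse.\<close>

lemma free_module_lift:
  fixes E :: "('b \<Rightarrow>\<^sub>0 ('v::finite, 'k::comm_ring_1) mpoly) \<Rightarrow> 'n::ab_group_add"
    and E' :: "('c \<Rightarrow>\<^sub>0 ('v, 'k) mpoly) \<Rightarrow> 'n"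
  assumes E: "module_hom smult s E" and E': "module_hom smult s E'"
    and deg: "\<And>b. b \<in> B \<Longrightarrow> sum (md b) UNIV = n"
    and deg': "\<And>b. b \<in> B' \<Longrightarrow> sum (md' b) UNIV = n"
    and bij: "\<And>c. sum c UNIV = n \<Longrightarrow> bij_betw E (graded_piece B md c) (K c)"
    and bij': "\<And>c. sum c UNIV = n \<Longrightarrow> bij_betw E' (graded_piece B' md' c) (K c)"
  shows "\<exists>\<phi>. module_hom smult smult \<phi> \<and> bij_betw \<phi> (free_module B) (free_module B') \<and>
    (\<forall>c. \<phi> ` graded_piece B md c = graded_piece B' md' c) \<and> (\<forall>f\<in>free_module B. E' (\<phi> f) = E f)"
proof -
  obtain D where D: "\<And>b. b \<in> B \<Longrightarrow> D b \<in> graded_piece B' md' (md b)"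
    and ED: "\<And>f. f \<in> free_module B \<Longrightarrow> E' (lin_ext D f) = E f"
    using free_module_lift_aux[OF E E' deg bij bij'] by blast
  obtain D' where D': "\<And>b. b \<in> B' \<Longrightarrow> D' b \<in> graded_piece B md (md' b)"
    and ED': "\<And>f. f \<in> free_module B' \<Longrightarrow> E (lin_ext D' f) = E' f"
    using free_module_lift_aux[OF E' E deg' bij' bij] by blast
  have inv: "lin_ext D' (lin_ext D f) = f" if "f \<in> free_module B" for f
    using free_module_lift_inverse[where E=E and E'=E', OF deg bij D ED D' ED' that] .
  have inv': "lin_ext D (lin_ext D' f) = f" if "f \<in> free_module B'" for f
    using free_module_lift_inverse[where E=E' and E'=E, OF deg' bij' D' ED' D ED that] .
  have "bij_betw (lin_ext D) (free_module B) (free_module B')"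
    using inv inv' graded_piece_free[OF D] graded_piece_free[OF D']
    by (intro bij_betw_byWitness[where f' = "lin_ext D'"])
      (auto intro: lin_ext_in_free_module[of B D] lin_ext_in_free_module[of B' D'])
  moreover have "lin_ext D ` graded_piece B md c = graded_piece B' md' c" for c
  proof (intro equalityI image_subsetI subsetI)
    show "lin_ext D f \<in> graded_piece B' md' c" if "f \<in> graded_piece B md c" for f :: "'b \<Rightarrow>\<^sub>0 ('v, 'k) mpoly"
      using lin_ext_in_graded_piece[of B D B' md' md f c] D that by blast
  next
    fix g :: "'c \<Rightarrow>\<^sub>0 ('v, 'k) mpoly"
    assume g: "g \<in> graded_piece B' md' c"
    then have "lin_ext D' g \<in> graded_piece B md c"
      using lin_ext_in_graded_piece[of B' D' B md md' g c] D' by blast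
    then show "g \<in> lin_ext D ` graded_piece B md c"
      using inv'[OF graded_piece_free[OF g]] by (metis imageI)
  qed
  ultimately show ?thesis
    using lin_ext_hom ED by blast
qed

section \<open>Linear presentations and their uniqueness\<close>

definition cycles ::
    "('b \<Rightarrow> ('v, 'k::comm_ring_1) mpoly) \<Rightarrow> ('b, 'v, 'k) free_complex \<Rightarrow> int \<Rightarrow> ('b \<Rightarrow>\<^sub>0 ('v, 'k) mpoly) set"
  where "cycles \<epsilon> F i =
    {f \<in> chain_module F i. if i = 0 then augmentation \<epsilon> f = 0 else boundary F i f = 0}"

text \<open>The data that determine a linear strand up to isomorphism. Bijectivity onto cycles is
  asked only in total degree \<open>i + 1 + d\<close>, where the basis of the next term lives; in
  higher degrees a linear strand can have homology. In homological degree 0 \<open>cycles\<close>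
  uses the augmentation, so the ideal and the later terms fit one recursion.\<close>

definition linear_presentation ::
    "int \<Rightarrow> ('v::finite, 'k::comm_ring_1) mpoly set \<Rightarrow> ('b, 'v, 'k) free_complex \<Rightarrow> ('b \<Rightarrow> ('v, 'k) mpoly) \<Rightarrow> bool"
  where "linear_presentation d I F \<epsilon> \<longleftrightarrow>
    (\<forall>i<0. basis F i = {}) \<and>
    (\<forall>i. \<forall>b\<in>basis F i. sum (mdeg F i b) UNIV = i + d) \<and>
    (\<forall>i. \<forall>b\<in>basis F i. diff F i b \<in> graded_part F (i - 1) (mdeg F i b)) \<and>
    (\<forall>c. sum c UNIV = d \<longrightarrow>
       bij_betw (augmentation \<epsilon>) (graded_part F 0 c) {p \<in> I. homogeneous_poly c p}) \<and>
    (\<forall>i\<ge>0. \<forall>c. sum c UNIV = i + 1 + d \<longrightarrow>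
       bij_betw (boundary F (i + 1)) (graded_part F (i + 1) c) (graded_part F i c \<inter> cycles \<epsilon> F i))"

lemma linear_presentation_boundary:
  assumes "linear_presentation d I F \<epsilon>" "f \<in> chain_module F i"
  shows "boundary F i f \<in> chain_module F (i - 1)"
proof -
  have "diff F i b \<in> free_module (basis F (i - 1))" if "b \<in> basis F i" for b
    using assms(1) that unfolding linear_presentation_def graded_part_eq by (blast dest: graded_piece_free)
  then show ?thesis
    using assms(2) unfolding chain_module_def boundary_def by (rule lin_ext_in_free_module)
qed

lemma bij_betw_image_Int:
  assumes "bij_betw f A B" "S \<subseteq> A" "f ` S = T" "\<And>x. x \<in> A \<Longrightarrow> x \<in> Z \<longleftrightarrow> f x \<in> Z'"
  shows "bij_betw f (S \<inter> Z) (T \<inter> Z')"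
  unfolding bij_betw_def
proof
  show "inj_on f (S \<inter> Z)"
    using assms by (meson bij_betw_def inf_le1 inj_on_subset)
  show "f ` (S \<inter> Z) = T \<inter> Z'"
    using assms by blast
qed

lemma linear_presentation_isomorphic:
  fixes G :: "('b, 'v::finite, 'k::comm_ring_1) free_complex" and L :: "('c, 'v, 'k) free_complex"
  assumes G: "linear_presentation d I G \<epsilon>" and L: "linear_presentation d I L \<epsilon>'"
  shows "complex_isomorphic G L"
proof -
  \<comment> \<open>Preservation of cycles belongs to the invariant because the map in degree
    \<open>i + 1\<close> is lifted through the cycles in degree \<open>i\<close>.\<close>
  define good where "good i \<phi> \<longleftrightarrow> module_hom smult smult \<phi> \<and>
      bij_betw \<phi> (chain_module G i) (chain_module L i) \<and>
      (\<forall>c. \<phi> ` graded_part G i c = graded_part L i c) \<and>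
      (\<forall>f\<in>chain_module G i. f \<in> cycles \<epsilon> G i \<longleftrightarrow> \<phi> f \<in> cycles \<epsilon>' L i)"
    for i and \<phi> :: "('b \<Rightarrow>\<^sub>0 ('v, 'k) mpoly) \<Rightarrow> ('c \<Rightarrow>\<^sub>0 ('v, 'k) mpoly)"
  define compat where "compat i \<phi> \<psi> \<longleftrightarrow>
      (\<forall>f\<in>chain_module G (i + 1). \<phi> (boundary G (i + 1) f) = boundary L (i + 1) (\<psi> f))"
    for i and \<phi> \<psi> :: "('b \<Rightarrow>\<^sub>0 ('v, 'k) mpoly) \<Rightarrow> ('c \<Rightarrow>\<^sub>0 ('v, 'k) mpoly)"
  have deg: "sum (mdeg G i b) UNIV = i + d" if "b \<in> basis G i" for i b
    using G that by (auto simp: linear_presentation_def)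
  have deg': "sum (mdeg L i b) UNIV = i + d" if "b \<in> basis L i" for i b
    using L that by (auto simp: linear_presentation_def)
  have bd: "boundary G i f \<in> chain_module G (i - 1)" if "f \<in> chain_module G i" for i f
    by (rule linear_presentation_boundary[OF G that])
  have init: "\<exists>\<phi>. good 0 \<phi>"
  proof -
    have "\<exists>\<phi>. module_hom smult smult \<phi> \<and> bij_betw \<phi> (free_module (basis G 0)) (free_module (basis L 0)) \<and>
        (\<forall>c. \<phi> ` graded_piece (basis G 0) (mdeg G 0) c = graded_piece (basis L 0) (mdeg L 0) c) \<and>
        (\<forall>f\<in>free_module (basis G 0). augmentation \<epsilon>' (\<phi> f) = augmentation \<epsilon> f)"
    proof (rule free_module_lift[OF augmentation_hom augmentation_hom])
      show "sum (mdeg G 0 b) UNIV = d" if "b \<in> basis G 0" for b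
        using deg[OF that] by simp
      show "sum (mdeg L 0 b) UNIV = d" if "b \<in> basis L 0" for b
        using deg'[OF that] by simp
      show "bij_betw (augmentation \<epsilon>) (graded_piece (basis G 0) (mdeg G 0) c) {p \<in> I. homogeneous_poly c p}"
        if "sum c UNIV = d" for c
        using G that unfolding linear_presentation_def graded_part_eq by blast
      show "bij_betw (augmentation \<epsilon>') (graded_piece (basis L 0) (mdeg L 0) c) {p \<in> I. homogeneous_poly c p}"
        if "sum c UNIV = d" for c
        using L that unfolding linear_presentation_def graded_part_eq by blast
    qed
    then obtain \<phi> where "module_hom smult smult \<phi>"
      and bij: "bij_betw \<phi> (chain_module G 0) (chain_module L 0)"
      and "\<And>c. \<phi> ` graded_part G 0 c = graded_part L 0 c"
      and aug: "\<And>f. f \<in> chain_module G 0 \<Longrightarrow> augmentation \<epsilon>' (\<phi> f) = augmentation \<epsilon> f"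
      unfolding graded_part_eq chain_module_def by blast
    moreover have "f \<in> cycles \<epsilon> G 0 \<longleftrightarrow> \<phi> f \<in> cycles \<epsilon>' L 0" if "f \<in> chain_module G 0" for f
      using bij_betwE[OF bij] aug[OF that] that by (simp add: cycles_def)
    ultimately show ?thesis
      unfolding good_def by blast
  qed
  have step: "\<exists>\<psi>. good (i + 1) \<psi> \<and> compat i \<phi> \<psi>" if "good i \<phi>" "i \<ge> 0" for i \<phi>
  proof -
    have \<phi>: "module_hom smult smult \<phi>" and bij: "bij_betw \<phi> (chain_module G i) (chain_module L i)"
      and img: "\<And>c. \<phi> ` graded_part G i c = graded_part L i c"
      and cyc: "\<And>f. f \<in> chain_module G i \<Longrightarrow> f \<in> cycles \<epsilon> G i \<longleftrightarrow> \<phi> f \<in> cycles \<epsilon>' L i"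
      using \<open>good i \<phi>\<close> by (auto simp: good_def)
    have hom: "module_hom smult smult (\<phi> \<circ> boundary G (i + 1))"
      unfolding boundary_def by (rule module_hom_compose[OF lin_ext_hom \<phi>])
    have hom': "module_hom smult smult (boundary L (i + 1))"
      unfolding boundary_def by (rule lin_ext_hom)
    \<comment> \<open>Transporting the boundary of \<open>G\<close> by \<open>\<phi>\<close> makes
      both boundaries map onto the same cycles of \<open>L\<close>, the common image required by
      \<open>free_module_lift\<close>.\<close>
    have b1: "bij_betw (\<phi> \<circ> boundary G (i + 1)) (graded_part G (i + 1) c) (graded_part L i c \<inter> cycles \<epsilon>' L i)"
      if "sum c UNIV = i + 1 + d" for c
    proof (rule bij_betw_trans)
      show "bij_betw (boundary G (i + 1)) (graded_part G (i + 1) c) (graded_part G i c \<inter> cycles \<epsilon> G i)"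
        using G that \<open>i \<ge> 0\<close> by (auto simp: linear_presentation_def)
      show "bij_betw \<phi> (graded_part G i c \<inter> cycles \<epsilon> G i) (graded_part L i c \<inter> cycles \<epsilon>' L i)"
        by (rule bij_betw_image_Int[OF bij _ img cyc]) (auto simp: graded_part_def)
    qed
    have b2: "bij_betw (boundary L (i + 1)) (graded_part L (i + 1) c) (graded_part L i c \<inter> cycles \<epsilon>' L i)"
      if "sum c UNIV = i + 1 + d" for c
      using L that \<open>i \<ge> 0\<close> by (auto simp: linear_presentation_def)
    obtain \<psi> where \<psi>: "module_hom smult smult \<psi>"
      "bij_betw \<psi> (chain_module G (i + 1)) (chain_module L (i + 1))"
      "\<And>c. \<psi> ` graded_part G (i + 1) c = graded_part L (i + 1) c"
      "\<And>f. f \<in> chain_module G (i + 1) \<Longrightarrow> boundary L (i + 1) (\<psi> f) = \<phi> (boundary G (i + 1) f)"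
      using free_module_lift[OF hom hom' deg deg' b1[unfolded graded_part_eq] b2[unfolded graded_part_eq]]
      unfolding graded_part_eq chain_module_def o_def by blast
    have "f \<in> cycles \<epsilon> G (i + 1) \<longleftrightarrow> \<psi> f \<in> cycles \<epsilon>' L (i + 1)" if f: "f \<in> chain_module G (i + 1)" for f
    proof -
      have "\<phi> 0 = 0"
        by (rule module_hom.zero[OF \<phi>])
      moreover have "boundary G (i + 1) f \<in> chain_module G i"
        using bd[OF f] by simp
      ultimately have "boundary G (i + 1) f = 0 \<longleftrightarrow> \<phi> (boundary G (i + 1) f) = 0"
        using bij_betw_imp_inj_on[OF bij] by (metis chain_module_def free_module_0 inj_onD)
      then show ?thesis
        using \<psi>(4)[OF f] f \<open>i \<ge> 0\<close> bij_betwE[OF \<psi>(2)] by (simp add: cycles_def)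
    qed
    then show ?thesis
      using \<psi> unfolding good_def compat_def by metis
  qed
  \<comment> \<open>Each map is chosen relative to the one below it, hence dependent choice along
    the naturals.\<close>
  have "\<exists>h. \<forall>n. good (int n) (h n) \<and> compat (int n) (h n) (h (Suc n))"
  proof (rule dependent_nat_choice)
    show "\<exists>\<phi>. good (int 0) \<phi>"
      using init by simp
    show "\<exists>\<psi>. good (int (Suc n)) \<psi> \<and> compat (int n) \<phi> \<psi>" if "good (int n) \<phi>" for n \<phi>
      using step[OF that] by (simp add: add.commute)
  qed
  then obtain h where h: "\<And>n. good (int n) (h n)" "\<And>n. compat (int n) (h n) (h (Suc n))"
    by blast
  \<comment> \<open>Below 0 both chain modules are \<open>{0}\<close>; the zero map is bijective
    there and makes the square at degree 0 commute.\<close>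
  define \<Phi> where "\<Phi> i = (if i < 0 then (\<lambda>_. 0) else h (nat i))" for i :: int
  have zero: "chain_module G i = {0}" "chain_module L i = {0}" "graded_part G i c = {0}" "graded_part L i c = {0}"
    if "i < 0" for i c
    using G L that by (auto simp: linear_presentation_def chain_module_def graded_part_def free_module_empty)
  have Z: "module_hom smult smult (\<lambda>_ :: 'b \<Rightarrow>\<^sub>0 ('v, 'k) mpoly. 0 :: 'c \<Rightarrow>\<^sub>0 ('v, 'k) mpoly)"
    by (rule module_pair.module_hom_zero) (simp add: module_pair_def module_smult)
  have "module_hom smult smult (\<Phi> i) \<and> bij_betw (\<Phi> i) (chain_module G i) (chain_module L i) \<and>
      (\<forall>c. \<Phi> i ` graded_part G i c = graded_part L i c) \<and>
      (\<forall>f\<in>chain_module G i. \<Phi> (i - 1) (boundary G i f) = boundary L i (\<Phi> i f))" for i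
  proof (cases "i < 0")
    case True
    then show ?thesis
      using Z by (simp add: \<Phi>_def zero bij_betw_def boundary_def lin_ext_0)
  next
    case False
    then obtain n where i: "i = int n"
      by (metis nonneg_int_cases not_less)
    have "\<Phi> (i - 1) (boundary G i f) = boundary L i (\<Phi> i f)" if f: "f \<in> chain_module G i" for f
    proof (cases n)
      case 0
      have "\<Phi> i f \<in> chain_module L i"
        using f h(1)[of n] i by (auto simp: \<Phi>_def good_def bij_betw_def)
      then have "boundary L i (\<Phi> i f) \<in> chain_module L (i - 1)"
        by (rule linear_presentation_boundary[OF L])
      then show ?thesis
        using 0 i zero[of "i - 1"] by (simp add: \<Phi>_def)
    next
      case (Suc m)
      then show ?thesis
        using h(2)[of m] f i by (simp add: compat_def \<Phi>_def add.commute nat_add_distrib)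
    qed
    then show ?thesis
      using h(1)[of n] False unfolding good_def by (simp add: \<Phi>_def i)
  qed
  then show ?thesis
    unfolding complex_isomorphic_def by blast
qed

section \<open>Monomial ideals\<close>

lemma span_mon_keys:
  assumes "p \<in> ideal_span (mon ` M)" "m \<in> keys p"
  shows "\<exists>n\<in>M. n \<subseteq># m"
proof -
  interpret module "(*) :: ('a, 'b) mpoly \<Rightarrow> _ \<Rightarrow> _"
    by (rule module_mult)
  show ?thesis
    using assms
  proof (induction arbitrary: m rule: span_induct_alt)
    case (step c x y)
    then obtain n where n: "n \<in> M" "x = mon n"
      by blast
    have "m \<in> keys (c * x) \<or> m \<in> keys y"
      using Poly_Mapping.keys_add[of "c * x" y] step.prems by blast
    then show ?case
    proof
      assume "m \<in> keys (c * x)"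
      then have "\<exists>a. m = a + n"
        using keys_mult[of c x] by (auto simp: n(2) mon_def split: if_splits)
      then show ?thesis
        using n(1) mset_subset_eq_add_right by blast
    qed (use step in blast)
  qed simp
qed

lemma keys_mon [simp]: "keys (mon m :: ('v, 'k::comm_ring_1) mpoly) = {m}"
  by (simp add: mon_def)

lemma mon_add: "mon (m + n) = mon m * mon n"
  by (simp add: mon_def mult_single)

lemma mon_in_span_iff:
  "(mon m :: ('v, 'k::comm_ring_1) mpoly) \<in> ideal_span (mon ` M) \<longleftrightarrow> (\<exists>n\<in>M. n \<subseteq># m)"
proof
  assume "\<exists>n\<in>M. n \<subseteq># m"
  then obtain n where n: "n \<in> M" "n \<subseteq># m"
    by blast
  then have "mon m = mon (m - n) * (mon n :: ('v, 'k) mpoly)"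
    by (metis mon_add subset_mset.diff_add)
  then show "(mon m :: ('v, 'k) mpoly) \<in> ideal_span (mon ` M)"
    using n(1) by (metis image_eqI module.span_base module.span_scale module_mult)
qed (use span_mon_keys[of "mon m"] in auto)

text \<open>Minimality of a resolution is used in this form: the entries of its differentials have
  no constant term.\<close>

lemma irrelevant_ideal_lookup:
  assumes "p \<in> irrelevant_ideal"
  shows "lookup p {#} = 0"
proof (rule ccontr)
  assume "lookup p {#} \<noteq> 0"
  then have "{#} \<in> keys p"
    by (simp add: in_keys_iff)
  then show False
    using span_mon_keys[of p "range (\<lambda>v. {#v#})" "{#}"] assms
    by (auto simp: irrelevant_ideal_def image_image)
qed

lemma min_gens_below:
  assumes "mon m \<in> I"
  shows "\<exists>n\<in>min_gens I. n \<subseteq># m"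
  using assms
proof (induction "size m" arbitrary: m rule: less_induct)
  case less
  show ?case
  proof (cases "m \<in> min_gens I")
    case False
    then obtain n where n: "mon n \<in> I" "n \<subseteq># m" "n \<noteq> m"
      using less.prems by (auto simp: min_gens_def)
    then have "size n < size m"
      by (simp add: mset_subset_size subset_mset.less_le)
    then show ?thesis
      using less.hyps n by (meson subset_mset.order_trans)
  qed auto
qed

lemma initial_degree_le:
  assumes "mon m \<in> I"
  shows "initial_degree I \<le> size m"
proof -
  obtain n where n: "n \<in> min_gens I" "n \<subseteq># m"
    using min_gens_below[OF assms] by blast
  have "initial_degree I \<le> size n"
    unfolding initial_degree_def using n(1) by (intro Least_le) blast
  also have "\<dots> \<le> size m"
    by (rule size_mset_mono[OF n(2)])
  finally show ?thesis .
qed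

lemma homogeneous_poly_degree:
  assumes "homogeneous_poly c p" "m \<in> keys p"
  shows "sum c UNIV = int (size (m :: 'v::finite multiset))"
proof -
  have "c = (\<lambda>v. int (count m v))"
    using assms by (auto simp: homogeneous_poly_def)
  moreover have "size m = (\<Sum>v\<in>UNIV. count m v)"
    unfolding size_multiset_overloaded_eq
    by (rule sum.mono_neutral_left) (auto simp: not_in_iff)
  ultimately show ?thesis
    by simp
qed

locale monomial_ideal =
  fixes I :: "('v, 'k::comm_ring_1) mpoly set" and M :: "'v multiset set"
  assumes I: "I = ideal_span (mon ` M)"
begin

lemma mon_in_ideal:
  assumes "p \<in> I" "m \<in> keys p"
  shows "mon m \<in> I"
  using span_mon_keys[of p M m] assms by (simp add: I mon_in_span_iff)

lemma ideal_mult: "p \<in> I \<Longrightarrow> r * p \<in> I"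
  unfolding I by (rule module.span_scale[OF module_mult])

lemma single_in_ideal: "mon m \<in> I \<Longrightarrow> single m k \<in> I"
  using ideal_mult[of "mon m" "single {#} k"] by (simp add: mon_def mult_single)

lemma initial_degree_attained:
  assumes "I \<noteq> {0}"
  shows "\<exists>m. mon m \<in> I \<and> size m = initial_degree I"
proof -
  have "0 \<in> I"
    unfolding I by (rule module.span_zero[OF module_mult])
  then obtain p where p: "p \<in> I" "p \<noteq> 0"
    using assms by blast
  then obtain m where "m \<in> keys p"
    by fastforce
  then obtain n where n: "n \<in> min_gens I"
    using min_gens_below[OF mon_in_ideal[OF p(1)]] by blast
  then have "\<exists>m\<in>min_gens I. initial_degree I = size m"
    using LeastI_ex[of "\<lambda>n. \<exists>m\<in>min_gens I. n = size m"] unfolding initial_degree_def by blast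
  then show ?thesis
    by (auto simp: min_gens_def)
qed

end

section \<open>The linear strand of a minimal free resolution\<close>

locale monomial_resolution = monomial_ideal I M
  for I :: "('v::finite, 'k::comm_ring_1) mpoly set" and M +
  fixes F :: "('b, 'v, 'k) free_complex" and \<epsilon> :: "'b \<Rightarrow> ('v, 'k) mpoly"
  assumes res: "minimal_free_resolution I F \<epsilon>" and nonzero: "I \<noteq> {0}"
begin

abbreviation d :: int where "d \<equiv> int (initial_degree I)"

abbreviation L :: "('b, 'v, 'k) free_complex" where "L \<equiv> linear_strand d F"

lemma diff_graded: "b \<in> basis F i \<Longrightarrow> diff F i b \<in> graded_piece (basis F (i - 1)) (mdeg F (i - 1)) (mdeg F i b)"
  using res[unfolded minimal_free_resolution_def, THEN conjunct1]
  by (simp add: graded_free_complex_def graded_part_eq)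

lemma basis_neg: "i < 0 \<Longrightarrow> basis F i = {}"
  using res[unfolded minimal_free_resolution_def, THEN conjunct2, THEN conjunct2, THEN conjunct1] by simp

lemma augmentation_image: "augmentation \<epsilon> ` chain_module F 0 = I"
  using res[unfolded minimal_free_resolution_def, THEN conjunct2, THEN conjunct2, THEN conjunct2, THEN conjunct2, THEN conjunct1] by simp

lemma augmentation_homogeneous: "b \<in> basis F 0 \<Longrightarrow> homogeneous_poly (mdeg F 0 b) (\<epsilon> b)"
  using res[unfolded minimal_free_resolution_def, THEN conjunct2, THEN conjunct2, THEN conjunct2, THEN conjunct1] by simp

lemma cycles_eq:
  assumes "i \<ge> 0"
  shows "cycles \<epsilon> F i = boundary F (i + 1) ` chain_module F (i + 1)"
proof (cases "i = 0")
  case True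
  have "{f \<in> chain_module F 0. augmentation \<epsilon> f = 0} = boundary F 1 ` chain_module F 1"
    using res[unfolded minimal_free_resolution_def, THEN conjunct2, THEN conjunct2, THEN conjunct2, THEN conjunct2, THEN conjunct2, THEN conjunct1] by simp
  then show ?thesis
    by (simp add: cycles_def True)
next
  case False
  then have "1 \<le> i"
    using assms by simp
  then have "{f \<in> chain_module F i. boundary F i f = 0} = boundary F (i + 1) ` chain_module F (i + 1)"
    using res[unfolded minimal_free_resolution_def, THEN conjunct2, THEN conjunct2, THEN conjunct2, THEN conjunct2, THEN conjunct2, THEN conjunct2, THEN conjunct1] by simp
  then show ?thesis
    by (simp add: cycles_def False)
qed

lemma minimal: "b \<in> basis F i \<Longrightarrow> lookup (diff F i b) c \<in> irrelevant_ideal"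
  using res[unfolded minimal_free_resolution_def, THEN conjunct2, THEN conjunct2, THEN conjunct2, THEN conjunct2, THEN conjunct2, THEN conjunct2, THEN conjunct2] by simp

lemma boundary_irrelevant:
  assumes "f \<in> chain_module F i"
  shows "lookup (boundary F i f) c \<in> irrelevant_ideal"
proof -
  have "lookup f b * lookup (diff F i b) c \<in> irrelevant_ideal" if "b \<in> keys f" for b
  proof -
    have "b \<in> basis F i"
      using assms that by (auto simp: chain_module_def free_module_def)
    then show ?thesis
      using minimal unfolding irrelevant_ideal_def by (blast intro: module.span_scale[OF module_mult])
  qed
  then show ?thesis
    unfolding boundary_def lookup_lin_ext augmentation_def irrelevant_ideal_def
    by (rule module.span_sum[OF module_mult])
qed

text \<open>A cycle is a boundary by exactness, so by minimality all its coefficients lie in the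
  irrelevant ideal, which does not contain 1.\<close>

lemma basis_not_cycle:
  assumes "i \<ge> 0" "b \<in> basis F i"
  shows "single b 1 \<notin> cycles \<epsilon> F i"
proof
  assume "single b 1 \<in> cycles \<epsilon> F i"
  then obtain f where "f \<in> chain_module F (i + 1)" "single b 1 = boundary F (i + 1) f"
    using cycles_eq[OF assms(1)] by blast
  then have "lookup (single b 1) b \<in> (irrelevant_ideal :: ('v, 'k) mpoly set)"
    using boundary_irrelevant by metis
  then show False
    using irrelevant_ideal_lookup[of "1 :: ('v, 'k) mpoly"] by (simp add: lookup_one)
qed

text \<open>Induction along the resolution: a basis element of the bottom term has a nonzero image
  in \<open>I\<close>, hence degree at least \<open>d\<close>; a later one has a nonzero
  differential, and by minimality its degree exceeds that of some basis element one step
  below.\<close>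

lemma basis_degree: "b \<in> basis F (int n) \<Longrightarrow> int n + d \<le> sum (mdeg F (int n) b) UNIV"
proof (induction n arbitrary: b)
  case 0
  have "single b 1 \<in> chain_module F 0"
    using 0 by (simp add: chain_module_def)
  then have "\<epsilon> b \<noteq> 0" and "\<epsilon> b \<in> I"
    using basis_not_cycle[of 0 b] 0 augmentation_image
    by (auto simp: cycles_def dest: imageI[where f = "augmentation \<epsilon>"])
  then obtain m where m: "m \<in> keys (\<epsilon> b)"
    by fastforce
  have "sum (mdeg F 0 b) UNIV = int (size m)"
    using homogeneous_poly_degree[OF augmentation_homogeneous m] 0 by simp
  moreover have "initial_degree I \<le> size m"
    using initial_degree_le mon_in_ideal \<open>\<epsilon> b \<in> I\<close> m by blast
  ultimately show ?case
    by simp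
next
  case (Suc n)
  have "single b 1 \<in> chain_module F (int (Suc n))"
    using Suc by (simp add: chain_module_def)
  then have "diff F (int (Suc n)) b \<noteq> 0"
    using basis_not_cycle[of "int (Suc n)" b] Suc(2)
    by (auto simp: cycles_def boundary_def module.scale_one[OF module_smult])
  then obtain c where c: "lookup (diff F (int (Suc n)) b) c \<noteq> 0"
    by (metis lookup_zero poly_mapping_eqI)
  then have cb: "c \<in> basis F (int n)"
    using diff_graded[OF Suc(2)] by (auto simp: graded_piece_def free_module_iff)
  obtain m where m: "m \<in> keys (lookup (diff F (int (Suc n)) b) c)"
    using c by fastforce
  have "m \<noteq> {#}"
    using irrelevant_ideal_lookup[OF minimal[OF Suc(2), of c]] m by (auto simp: in_keys_iff)
  then have "size m \<ge> 1"
    by (simp add: Suc_leI nonempty_has_size)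
  moreover have "(\<Sum>v\<in>UNIV. mdeg F (int (Suc n)) b v - mdeg F (int n) c v) = int (size m)"
    using homogeneous_poly_degree[OF graded_piece_homogeneous[OF diff_graded[OF Suc(2)]] m] by simp
  ultimately show ?case
    using Suc.IH[OF cb] by (simp add: sum_subtractf)
qed

lemma basis_degree_int:
  assumes "b \<in> basis F i"
  shows "i + d \<le> sum (mdeg F i b) UNIV"
proof -
  have "i \<ge> 0"
    using basis_neg assms by force
  then show ?thesis
    using basis_degree[of b "nat i"] assms by simp
qed

lemma graded_part_degree:
  assumes "f \<in> graded_part F i c" "lookup f b \<noteq> 0"
  shows "b \<in> basis F i" "sum (mdeg F i b) UNIV \<le> sum c UNIV"
proof -
  show "b \<in> basis F i"
    using assms by (auto simp: graded_part_eq graded_piece_def free_module_iff)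
  obtain m where m: "m \<in> keys (lookup f b)"
    using assms(2) by fastforce
  have "(\<Sum>v\<in>UNIV. c v - mdeg F i b v) = int (size m)"
    using homogeneous_poly_degree[OF graded_piece_homogeneous m] assms(1) by (simp add: graded_part_eq)
  then show "sum (mdeg F i b) UNIV \<le> sum c UNIV"
    by (simp add: sum_subtractf)
qed

lemma graded_part_small:
  assumes "f \<in> graded_part F i c" "sum c UNIV < i + d"
  shows "f = 0"
proof (rule poly_mapping_eqI)
  show "lookup f b = lookup 0 b" for b
    using graded_part_degree[OF assms(1), of b] basis_degree_int[of b i] assms(2) by fastforce
qed

text \<open>By \<open>basis_degree_int\<close> no strand below \<open>d\<close> is nonzero. Strand
  \<open>d\<close> is nonzero because a monomial of degree \<open>d\<close> in \<open>I\<close> has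
  a homogeneous preimage, which can only involve basis elements of total degree
  \<open>d\<close>.\<close>

lemma first_linear_strand_eq: "first_linear_strand F = L"
proof -
  obtain m where m: "mon m \<in> I" "size m = initial_degree I"
    using initial_degree_attained nonzero by blast
  then obtain f where f: "f \<in> chain_module F 0" "augmentation \<epsilon> f = mon m"
    using augmentation_image by (metis imageE)
  define c where "c = (\<lambda>v. int (count m v))"
  have hm: "homogeneous_poly c (mon m :: ('v, 'k) mpoly)"
    by (simp add: homogeneous_poly_def c_def)
  have deg: "sum c UNIV = d"
    using homogeneous_poly_degree[OF hm, of m] m(2) by simp
  have "homogeneous_part c (mon m) = augmentation \<epsilon> (graded_comp (mdeg F 0) c f)"
    using homogeneous_part_augmentation[of "basis F 0" "mdeg F 0" "\<lambda>_. 0" \<epsilon> f c] f augmentation_homogeneous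
    by (simp add: chain_module_def)
  then have "augmentation \<epsilon> (graded_comp (mdeg F 0) c f) = mon m"
    using homogeneous_part_eq[OF hm] by simp
  then have "graded_comp (mdeg F 0) c f \<noteq> 0"
    by (metis augmentation_0 keys_mon keys_zero insert_not_empty)
  then obtain b where b: "lookup (graded_comp (mdeg F 0) c f) b \<noteq> 0"
    by (metis lookup_zero poly_mapping_eqI)
  have "graded_comp (mdeg F 0) c f \<in> graded_part F 0 c"
    using f(1) by (auto simp: graded_part_eq chain_module_def intro: graded_comp_in_graded_piece)
  then have "b \<in> strand_basis d F 0"
    using graded_part_degree[OF _ b] basis_degree_int[of b 0] deg by (fastforce simp: strand_basis_def)
  then have "(LEAST r. \<exists>i. strand_basis r F i \<noteq> {}) = d"
    using basis_degree_int by (intro Least_equality) (fastforce simp: strand_basis_def)+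
  then show ?thesis
    by (simp add: first_linear_strand_def linear_strand_def)
qed

lemma basis_L [simp]: "basis L i = strand_basis d F i"
  by (simp add: linear_strand_def)

lemma mdeg_L [simp]: "mdeg L = mdeg F"
  by (simp add: linear_strand_def)

lemma graded_part_L_subset: "graded_part L i c \<subseteq> graded_part F i c"
proof
  fix f assume f: "f \<in> graded_part L i c"
  have "f \<in> free_module (basis F i)"
    using graded_piece_free[OF f[unfolded graded_part_eq]]
    unfolding basis_L free_module_def strand_basis_def by blast
  then show "f \<in> graded_part F i c"
    using graded_piece_homogeneous[OF f[unfolded graded_part_eq]]
    by (simp add: graded_part_eq graded_piece_def)
qed

lemma graded_part_L_eq:
  assumes "sum c UNIV = i + d"
  shows "graded_part L i c = graded_part F i c"
proof (intro equalityI subsetI)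
  fix f assume f: "f \<in> graded_part F i c"
  have "b \<in> strand_basis d F i" if "b \<in> keys f" for b
    using graded_part_degree[OF f, of b] that basis_degree_int[of b i] assms
    by (auto simp: in_keys_iff strand_basis_def)
  then have "f \<in> free_module (basis L i)"
    by (auto simp: free_module_def)
  then show "f \<in> graded_part L i c"
    using graded_piece_homogeneous[OF f[unfolded graded_part_eq]]
    by (simp add: graded_part_eq graded_piece_def)
qed (use graded_part_L_subset in blast)

text \<open>Entries without constant term lower the degree of the generator by at least one, and the
  term below has no generators of degree less than \<open>i - 1 + d\<close>. So the differential
  stays inside the strand, and the projection in \<open>linear_strand\<close> changes
  nothing.\<close>

lemma diff_L:
  assumes "b \<in> strand_basis d F i"
  shows "diff L i b = diff F i b" "diff F i b \<in> graded_part L (i - 1) (mdeg F i b)"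
proof -
  have b: "b \<in> basis F i" "sum (mdeg F i b) UNIV = i + d"
    using assms by (auto simp: strand_basis_def)
  define g where "g = diff F i b"
  have g: "g \<in> graded_part F (i - 1) (mdeg F i b)"
    using diff_graded[OF b(1)] by (simp add: graded_part_eq g_def)
  have keys: "c \<in> strand_basis d F (i - 1)" if c: "lookup g c \<noteq> 0" for c
  proof -
    have cb: "c \<in> basis F (i - 1)"
      by (rule graded_part_degree[OF g c])
    obtain m where m: "m \<in> keys (lookup g c)"
      using c by fastforce
    have "m \<noteq> {#}"
      using irrelevant_ideal_lookup[OF minimal[OF b(1), of c]] m by (auto simp: in_keys_iff g_def)
    then have "size m \<ge> 1"
      by (simp add: Suc_leI nonempty_has_size)
    moreover have "(\<Sum>v\<in>UNIV. mdeg F i b v - mdeg F (i - 1) c v) = int (size m)"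
      using homogeneous_poly_degree[OF graded_piece_homogeneous[OF g[unfolded graded_part_eq]] m] .
    ultimately show ?thesis
      using basis_degree_int[OF cb] cb b(2) by (simp add: sum_subtractf strand_basis_def)
  qed
  have "restrict_to (strand_basis d F (i - 1)) g = g"
    by (rule poly_mapping_eqI) (use keys in \<open>auto simp: restrict_to_def lookup_mapp when_def in_keys_iff\<close>)
  then show "diff L i b = diff F i b"
    by (simp add: linear_strand_def g_def)
  have "g \<in> free_module (basis L (i - 1))"
    using keys by (auto simp: free_module_iff)
  then have "g \<in> graded_part L (i - 1) (mdeg F i b)"
    using graded_piece_homogeneous[OF g[unfolded graded_part_eq]]
    by (simp add: graded_part_eq graded_piece_def)
  then show "diff F i b \<in> graded_part L (i - 1) (mdeg F i b)"
    by (simp add: g_def)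
qed

lemma chain_module_L_subset: "chain_module L i \<subseteq> chain_module F i"
  by (auto simp: chain_module_def free_module_def strand_basis_def)

lemma boundary_L: "f \<in> chain_module L i \<Longrightarrow> boundary L i f = boundary F i f"
  unfolding boundary_def chain_module_def using diff_L by (intro lin_ext_cong) auto

lemma boundary_L_graded:
  assumes "f \<in> graded_part L i c"
  shows "boundary L i f \<in> graded_part L (i - 1) c"
  using assms diff_L
    lin_ext_in_graded_piece[of "basis L i" "diff L i" "basis L (i - 1)" "mdeg L (i - 1)" "mdeg L i" f c]
  unfolding graded_part_eq boundary_def by simp

lemma cycles_L:
  assumes "f \<in> chain_module L i"
  shows "f \<in> cycles \<epsilon> L i \<longleftrightarrow> f \<in> cycles \<epsilon> F i"
  using assms chain_module_L_subset boundary_L[OF assms] by (auto simp: cycles_def)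

lemma cycles_graded:
  assumes "i \<ge> 0" "f \<in> graded_part F i c"
  shows "f \<in> cycles \<epsilon> F i \<longleftrightarrow> f \<in> boundary F (i + 1) ` graded_part F (i + 1) c"
proof
  assume "f \<in> cycles \<epsilon> F i"
  then obtain h where h: "h \<in> chain_module F (i + 1)" "f = boundary F (i + 1) h"
    using cycles_eq[OF assms(1)] by blast
  have "f = graded_comp (mdeg F i) c f"
    using graded_comp_eq[OF assms(2)[unfolded graded_part_eq]] by simp
  also have "\<dots> = boundary F (i + 1) (graded_comp (mdeg F (i + 1)) c h)"
    using graded_comp_lin_ext[of "basis F (i + 1)" "diff F (i + 1)" "basis F i" "mdeg F i" "mdeg F (i + 1)" h c]
      diff_graded[of _ "i + 1"] h by (simp add: boundary_def chain_module_def)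
  finally show "f \<in> boundary F (i + 1) ` graded_part F (i + 1) c"
    using h(1) graded_comp_in_graded_piece by (metis chain_module_def graded_part_eq imageI)
qed (use cycles_eq[OF assms(1)] in \<open>auto simp: graded_part_def\<close>)

text \<open>A preimage of the same multidegree lies below the least degree \<open>i + 1 + d\<close>
  of the next term and is therefore 0. This provides injectivity of the augmentation and of the
  boundaries.\<close>

lemma cycles_small:
  assumes "i \<ge> 0" "f \<in> graded_part F i c" "sum c UNIV = i + d" "f \<in> cycles \<epsilon> F i"
  shows "f = 0"
proof -
  obtain h where "h \<in> graded_part F (i + 1) c" "f = boundary F (i + 1) h"
    using cycles_graded assms by blast
  then show ?thesis
    using graded_part_small[of h "i + 1" c] assms(3) by (simp add: boundary_def lin_ext_0)
qed

text \<open>The source of each map is a graded part on which strand and resolution agree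
  (\<open>graded_part_L_eq\<close>); injectivity is \<open>cycles_small\<close>, surjectivity is
  exactness after projecting a preimage to multidegree \<open>c\<close>.\<close>

theorem linear_strand_presentation: "linear_presentation d I L \<epsilon>"
  unfolding linear_presentation_def
proof (intro conjI allI impI ballI)
  show "basis L i = {}" if "i < 0" for i
    using basis_neg[OF that] by (simp add: strand_basis_def)
  show "sum (mdeg L i b) UNIV = i + d" if "b \<in> basis L i" for i b
    using that by (simp add: strand_basis_def)
  show "diff L i b \<in> graded_part L (i - 1) (mdeg L i b)" if "b \<in> basis L i" for i b
    using diff_L[of b i] that by simp
next
  fix c :: "'v \<Rightarrow> int" assume c: "sum c UNIV = d"
  have comp: "homogeneous_part c (augmentation \<epsilon> f) = augmentation \<epsilon> (graded_comp (mdeg F 0) c f)"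
    if "f \<in> chain_module F 0" for f
    using homogeneous_part_augmentation[of "basis F 0" "mdeg F 0" "\<lambda>_. 0" \<epsilon> f c] that augmentation_homogeneous
    by (simp add: chain_module_def)
  have L: "graded_part L 0 c = graded_part F 0 c"
    using graded_part_L_eq[of c 0] c by simp
  show "bij_betw (augmentation \<epsilon>) (graded_part L 0 c) {p \<in> I. homogeneous_poly c p}"
    unfolding bij_betw_def L
  proof (intro conjI equalityI inj_onI subsetI)
    fix f g assume fg: "f \<in> graded_part F 0 c" "g \<in> graded_part F 0 c" "augmentation \<epsilon> f = augmentation \<epsilon> g"
    have "augmentation \<epsilon> (f - g) = 0"
      using fg(3) module_hom.diff[OF augmentation_hom] by (metis diff_self)
    then have "f - g \<in> cycles \<epsilon> F 0"
      using graded_part_diff[OF fg(1,2)] by (simp add: cycles_def graded_part_def)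
    then have "f - g = 0"
      using cycles_small[OF _ graded_part_diff[OF fg(1,2)]] c by simp
    then show "f = g"
      by simp
  next
    fix p assume "p \<in> augmentation \<epsilon> ` graded_part F 0 c"
    then obtain f where f: "f \<in> graded_part F 0 c" "p = augmentation \<epsilon> f"
      by blast
    have fc: "f \<in> chain_module F 0"
      using f(1) by (simp add: graded_part_def)
    have "p = homogeneous_part c p"
      using comp[OF fc] f(2) graded_comp_eq[OF f(1)[unfolded graded_part_eq]] by simp
    then show "p \<in> {p \<in> I. homogeneous_poly c p}"
      using f(2) fc augmentation_image by (metis homogeneous_part_homogeneous image_eqI mem_Collect_eq)
  next
    fix p assume p: "p \<in> {p \<in> I. homogeneous_poly c p}"
    then obtain f where f: "f \<in> chain_module F 0" "p = augmentation \<epsilon> f"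
      using augmentation_image by blast
    have "p = augmentation \<epsilon> (graded_comp (mdeg F 0) c f)"
      using comp[OF f(1)] p f(2) homogeneous_part_eq by (metis (mono_tags, lifting) mem_Collect_eq)
    then show "p \<in> augmentation \<epsilon> ` graded_part F 0 c"
      using graded_comp_in_graded_piece f(1) by (metis chain_module_def graded_part_eq imageI)
  qed
next
  fix i and c :: "'v \<Rightarrow> int" assume i: "0 \<le> i" and c: "sum c UNIV = i + 1 + d"
  have L: "graded_part L (i + 1) c = graded_part F (i + 1) c"
    using graded_part_L_eq c by simp
  have bd: "boundary L (i + 1) f = boundary F (i + 1) f" if "f \<in> graded_part F (i + 1) c" for f
    using that unfolding L[symmetric] by (intro boundary_L) (simp add: graded_part_def)
  show "bij_betw (boundary L (i + 1)) (graded_part L (i + 1) c) (graded_part L i c \<inter> cycles \<epsilon> L i)"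
    unfolding bij_betw_def L
  proof (intro conjI equalityI inj_onI subsetI)
    fix f g assume fg: "f \<in> graded_part F (i + 1) c" "g \<in> graded_part F (i + 1) c"
      "boundary L (i + 1) f = boundary L (i + 1) g"
    have "boundary F (i + 1) (f - g) = 0"
      using fg(3) bd[OF fg(1)] bd[OF fg(2)] module_hom.diff[OF lin_ext_hom, of "diff F (i + 1)" f g]
      by (simp add: boundary_def)
    then have "f - g \<in> cycles \<epsilon> F (i + 1)"
      using graded_part_diff[OF fg(1,2)] i by (simp add: cycles_def graded_part_def)
    then have "f - g = 0"
      using cycles_small[OF _ graded_part_diff[OF fg(1,2)]] c i by simp
    then show "f = g"
      by simp
  next
    fix z assume "z \<in> boundary L (i + 1) ` graded_part F (i + 1) c"
    then obtain f where f: "f \<in> graded_part F (i + 1) c" "z = boundary L (i + 1) f"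
      by blast
    have z: "z \<in> graded_part L i c"
      using boundary_L_graded[of f "i + 1" c] f L by simp
    moreover have "z \<in> cycles \<epsilon> F i"
      unfolding cycles_eq[OF i] using f bd[OF f(1)] by (simp add: graded_part_def)
    ultimately show "z \<in> graded_part L i c \<inter> cycles \<epsilon> L i"
      using cycles_L[of z i] by (simp add: graded_part_def)
  next
    fix z assume z: "z \<in> graded_part L i c \<inter> cycles \<epsilon> L i"
    then have "z \<in> graded_part F i c" "z \<in> cycles \<epsilon> F i"
      using graded_part_L_subset cycles_L[of z i] by (auto simp: graded_part_def)
    then obtain f where "f \<in> graded_part F (i + 1) c" "z = boundary F (i + 1) f"
      using cycles_graded[OF i] by blast
    then show "z \<in> boundary L (i + 1) ` graded_part F (i + 1) c"
      using bd by force
  qed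
qed

end

section \<open>Combinatorics of transversals\<close>

text \<open>The sets \<open>S j\<close> act as colour classes; they will be the supports of the
  \<open>a_j\<close>, and \<open>E\<close> the edges of the clutter of \<open>I\<close>.\<close>

locale transversal_clutter =
  fixes d :: nat and S :: "nat \<Rightarrow> 'v::finite set" and E :: "'v set set" and pos :: "'v \<Rightarrow> nat"
  assumes disjoint: "i < d \<Longrightarrow> j < d \<Longrightarrow> i \<noteq> j \<Longrightarrow> S i \<inter> S j = {}"
    and inj_pos: "inj pos"
begin

definition transversal :: "'v set \<Rightarrow> bool" where
  "transversal T \<longleftrightarrow> (\<exists>t. (\<forall>j<d. t j \<in> S j) \<and> T = t ` {..<d})"

definition hits :: "'v set \<Rightarrow> bool" where
  "hits A \<longleftrightarrow> (\<forall>j<d. A \<inter> S j \<noteq> {})"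

definition faces :: "'v set set" where
  "faces = {A. A \<subseteq> (\<Union>j<d. S j) \<and> (\<forall>T. transversal T \<and> T \<subseteq> A \<longrightarrow> T \<in> E) \<and> hits A}"

lemma S_unique: "x \<in> S i \<Longrightarrow> x \<in> S j \<Longrightarrow> i < d \<Longrightarrow> j < d \<Longrightarrow> i = j"
  using disjoint by blast

lemma transversal_card:
  assumes "transversal T"
  shows "card T = d"
proof -
  obtain t where t: "\<And>j. j < d \<Longrightarrow> t j \<in> S j" "T = t ` {..<d}"
    using assms by (auto simp: transversal_def)
  then have "inj_on t {..<d}"
    using S_unique by (metis inj_onI lessThan_iff)
  then show ?thesis
    by (simp add: t(2) card_image)
qed

lemma transversal_hits: "transversal T \<Longrightarrow> hits T"
  by (auto simp: transversal_def hits_def)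

lemma transversal_unique:
  assumes "transversal T" "x \<in> T" "y \<in> T" "x \<in> S j" "y \<in> S j" "j < d"
  shows "x = y"
  using assms S_unique unfolding transversal_def by (metis image_iff lessThan_iff)

lemma hits_obtains_transversal:
  assumes "hits A"
  obtains T where "transversal T" "T \<subseteq> A"
proof -
  have "\<forall>j. \<exists>x. j < d \<longrightarrow> x \<in> A \<inter> S j"
    using assms by (auto simp: hits_def)
  then obtain t where "\<And>j. j < d \<Longrightarrow> t j \<in> A \<inter> S j"
    by metis
  then show ?thesis
    using that[of "t ` {..<d}"] by (auto simp: transversal_def)
qed

lemma hits_mono: "hits A \<Longrightarrow> A \<subseteq> B \<Longrightarrow> hits B"
  unfolding hits_def by blast

lemma hits_card_le:
  assumes "hits A"
  shows "d \<le> card A"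
  using hits_obtains_transversal[OF assms] transversal_card by (metis card_mono finite)

lemma hits_card_eq:
  assumes "hits A" "card A = d"
  shows "transversal A"
  using hits_obtains_transversal[OF assms(1)] transversal_card assms(2)
  by (metis card_subset_eq finite)

lemma faces_hits: "A \<in> faces \<Longrightarrow> hits A"
  by (simp add: faces_def)

lemma faces_subset: "A \<in> faces \<Longrightarrow> x \<in> A \<Longrightarrow> \<exists>j<d. x \<in> S j"
  by (auto simp: faces_def)

lemma faces_transversal: "A \<in> faces \<Longrightarrow> transversal T \<Longrightarrow> T \<subseteq> A \<Longrightarrow> T \<in> E"
  by (auto simp: faces_def)

lemma facesI:
  assumes "\<And>x. x \<in> A \<Longrightarrow> \<exists>j<d. x \<in> S j" "\<And>T. transversal T \<Longrightarrow> T \<subseteq> A \<Longrightarrow> T \<in> E" "hits A"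
  shows "A \<in> faces"
  using assms unfolding faces_def by blast

lemma faces_down: "A \<in> faces \<Longrightarrow> B \<subseteq> A \<Longrightarrow> hits B \<Longrightarrow> B \<in> faces"
  unfolding faces_def by blast

lemma faces_between: "A \<in> faces \<Longrightarrow> transversal T \<Longrightarrow> T \<subseteq> B \<Longrightarrow> B \<subseteq> A \<Longrightarrow> B \<in> faces"
  by (rule faces_down[OF _ _ hits_mono[OF transversal_hits]])

lemma faces_remove:
  assumes "A \<in> faces" "d < card A"
  obtains u where "u \<in> A" "A - {u} \<in> faces"
proof -
  obtain T where T: "transversal T" "T \<subseteq> A"
    using hits_obtains_transversal[OF faces_hits[OF assms(1)]] .
  then have "T \<noteq> A"
    using assms(2) transversal_card by blast
  then obtain u where u: "u \<in> A" "u \<notin> T"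
    using T(2) by blast
  have "A - {u} \<in> faces"
    by (rule faces_between[OF assms(1) T(1)]) (use T(2) u(2) in auto)
  then show ?thesis
    using that u(1) by blast
qed

lemma hits_exchange:
  assumes "transversal T" "v \<in> S j" "x \<in> S j" "j < d"
  shows "hits (insert x (T - {v}))"
proof -
  have "insert x (T - {v}) \<inter> S k \<noteq> {}" if "k < d" for k
  proof (cases "k = j")
    case False
    obtain y where "y \<in> T" "y \<in> S k"
      using transversal_hits[OF assms(1)] \<open>k < d\<close> unfolding hits_def by blast
    moreover have "y \<noteq> v"
      using S_unique[of v k j] False assms(2,4) \<open>k < d\<close> \<open>y \<in> S k\<close> by auto
    ultimately show ?thesis
      by blast
  qed (use assms in blast)
  then show ?thesis
    by (simp add: hits_def)
qed

text \<open>\<open>\<kappa> w\<close> stands for the signed coefficient of a cycle at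
  \<open>C - {w}\<close>. With at least \<open>d + 2\<close> elements in \<open>C\<close>, a facet
  has more elements than any transversal inside it; the spare vertex \<open>u\<close> links facets
  that cannot be compared directly.\<close>

lemma cycle_constant:
  fixes \<kappa> :: "'v \<Rightarrow> 'k::zero"
  assumes C: "d + 2 \<le> card C"
    and eq: "\<And>u v. u \<in> C \<Longrightarrow> v \<in> C \<Longrightarrow> u \<noteq> v \<Longrightarrow> C - {u, v} \<in> faces \<Longrightarrow> \<kappa> u = \<kappa> v"
    and zero: "\<And>w. w \<in> C \<Longrightarrow> C - {w} \<notin> faces \<Longrightarrow> \<kappa> w = 0"
    and v: "v \<in> C" "\<kappa> v \<noteq> 0"
  shows "C \<in> faces" "w \<in> C \<Longrightarrow> C - {w} \<in> faces \<Longrightarrow> \<kappa> w = \<kappa> v"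
proof -
  define C' where "C' = C - {v}"
  have C': "C' \<in> faces" "d < card C'"
    using zero v C by (auto simp: C'_def)
  \<comment> \<open>Comparison with \<open>v\<close> propagates the nonzero value, and
    \<open>zero\<close> then makes \<open>C - {u}\<close> a face.\<close>
  have eq': "\<kappa> u = \<kappa> v" "C - {u} \<in> faces" if "u \<in> C'" "C' - {u} \<in> faces" for u
  proof -
    have "C - {u, v} = C' - {u}"
      by (auto simp: C'_def)
    then show "\<kappa> u = \<kappa> v"
      using eq[of u v] that v(1) by (auto simp: C'_def)
    then show "C - {u} \<in> faces"
      using zero[of u] that(1) v(2) by (auto simp: C'_def)
  qed
  obtain u where "u \<in> C'" "C' - {u} \<in> faces"
    using faces_remove[OF C'] .
  \<comment> \<open>Only through a face containing it, here \<open>C - {u}\<close>, is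
    \<open>v\<close> seen to lie in a colour class.\<close>
  then have "C - {u} \<in> faces" "v \<in> C - {u}"
    using eq' v(1) by (auto simp: C'_def)
  then obtain j where j: "j < d" "v \<in> S j"
    using faces_subset by blast
  obtain x where x: "x \<in> C'" "x \<in> S j"
    using faces_hits[OF C'(1)] j(1) unfolding hits_def by blast
  show C_face: "C \<in> faces"
  proof (rule facesI)
    show "\<exists>j<d. y \<in> S j" if "y \<in> C" for y
      using that faces_subset[OF C'(1)] j by (cases "y = v") (auto simp: C'_def)
    show "hits C"
      by (rule hits_mono[OF faces_hits[OF C'(1)]]) (auto simp: C'_def)
    fix T assume T: "transversal T" "T \<subseteq> C"
    show "T \<in> E"
    proof (cases "v \<in> T")
      case True
      \<comment> \<open>Exchanging \<open>v\<close> for \<open>x\<close> of the same colour moves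
        \<open>T\<close> into \<open>C'\<close>. A vertex \<open>u\<close> of \<open>C'\<close>
        outside the new transversal is also outside \<open>T\<close>, so \<open>T\<close> lies in
        the face \<open>C - {u}\<close> and is an edge.\<close>
      have "hits (insert x (T - {v}))"
        by (rule hits_exchange[OF T(1) j(2) x(2) j(1)])
      then obtain T' where T': "transversal T'" "T' \<subseteq> insert x (T - {v})"
        using hits_obtains_transversal by blast
      have "card (insert x (T - {v})) \<le> d"
        using True transversal_card[OF T(1)] card_insert_le_m1[of d "T - {v}" x]
        by (cases "d = 0") (auto simp: card_insert_if)
      then have *: "insert x (T - {v}) = T'"
        using T' transversal_card by (metis card_seteq finite)
      have "T' \<subseteq> C'"
        using T(2) x(1) unfolding *[symmetric] C'_def by blast
      moreover have "T' \<noteq> C'"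
        using C'(2) transversal_card[OF T'(1)] by auto
      ultimately obtain u where u: "u \<in> C'" "u \<notin> T'"
        by blast
      have "C' - {u} \<in> faces"
        by (rule faces_between[OF C'(1) T'(1)]) (use \<open>T' \<subseteq> C'\<close> u(2) in auto)
      then have "C - {u} \<in> faces"
        using eq' u(1) by blast
      moreover have "T \<subseteq> C - {u}"
        using T(2) u unfolding *[symmetric] C'_def by blast
      ultimately show ?thesis
        using faces_transversal T(1) by blast
    next
      case False
      then show ?thesis
        using faces_transversal[OF C'(1) T(1)] T(2) by (auto simp: C'_def)
    qed
  qed
  show "\<kappa> w = \<kappa> v" if w: "w \<in> C" "C - {w} \<in> faces"
  proof (cases "w = v \<or> C - {v, w} \<in> faces")
    case True
    then show ?thesis
      using eq v(1) w(1) by metis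
  next
    case False
    \<comment> \<open>Now \<open>v\<close> and \<open>w\<close> turn out to be the only vertices of
      \<open>C\<close> with their colour, so a detour through a third facet is needed.\<close>
    then obtain k where k: "k < d" "(C - {v, w}) \<inter> S k = {}"
      using faces_down[OF C_face, of "C - {v, w}"] unfolding hits_def by blast
    have "v \<in> S k"
      using faces_hits[OF w(2)] k unfolding hits_def by blast
    then have "k = j"
      using S_unique j k(1) by blast
    have "w \<in> S j"
      using faces_hits[OF C'(1)] k unfolding hits_def C'_def \<open>k = j\<close> by blast
    obtain T where T: "transversal T" "T \<subseteq> C'"
      using hits_obtains_transversal[OF faces_hits[OF C'(1)]] .
    then have "T \<noteq> C'"
      using C'(2) transversal_card by blast
    then obtain u where u: "u \<in> C'" "u \<notin> T"
      using T(2) by blast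
    have "w \<in> T"
      using transversal_hits[OF T(1)] T(2) k unfolding hits_def C'_def \<open>k = j\<close> by blast
    have "C' - {u} \<in> faces"
      by (rule faces_between[OF C'(1) T(1)]) (use T(2) u(2) in auto)
    then have 1: "\<kappa> u = \<kappa> v"
      using eq' u(1) by blast
    \<comment> \<open>The value at \<open>u\<close> equals that at \<open>v\<close> since
      \<open>C' - {u}\<close> contains \<open>T\<close>; it equals that at \<open>w\<close> since
      \<open>C - {u, w}\<close> contains \<open>T\<close> with \<open>w\<close> exchanged for
      \<open>v\<close>.\<close>
    have "hits (insert v (T - {w}))"
      by (rule hits_exchange[OF T(1) \<open>w \<in> S j\<close> j(2) j(1)])
    moreover have "insert v (T - {w}) \<subseteq> C - {u, w}"
      using T(2) u v(1) False unfolding C'_def by blast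
    ultimately have "hits (C - {u, w})"
      by (rule hits_mono)
    then have "C - {u, w} \<in> faces"
      by (intro faces_down[OF C_face]) auto
    then have "\<kappa> u = \<kappa> w"
      using eq[of u w] u w(1) \<open>w \<in> T\<close> by (auto simp: C'_def)
    then show ?thesis
      using 1 by simp
  qed
qed

section \<open>Signs of facets and of transversals\<close>

definition face_sign :: "'v \<Rightarrow> 'v set \<Rightarrow> int" where
  "face_sign w A = (-1) ^ card {x \<in> A. pos x < pos w}"

lemma face_sign_square [simp]: "face_sign w A * face_sign w A = 1"
  by (simp add: face_sign_def flip: power_add)

lemma face_sign_insert:
  assumes "u \<notin> B"
  shows "face_sign w (insert u B) = (if pos u < pos w then - face_sign w B else face_sign w B)"
proof -
  have "{x \<in> insert u B. pos x < pos w} =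
      (if pos u < pos w then insert u {x \<in> B. pos x < pos w} else {x \<in> B. pos x < pos w})"
    by auto
  then show ?thesis
    using assms by (simp add: face_sign_def)
qed

text \<open>Exactly one of \<open>u\<close>, \<open>v\<close> precedes the other in the numbering,
  so exactly one of the two counts changes; this is the sign behind the vanishing of the squared
  boundary.\<close>

lemma face_sign_swap:
  assumes "u \<noteq> v" "u \<notin> B" "v \<notin> B"
  shows "face_sign v (insert u B) * face_sign u B = - (face_sign u (insert v B) * face_sign v B)"
proof -
  have "pos u \<noteq> pos v"
    using inj_pos assms(1) by (simp add: inj_eq)
  then show ?thesis
    using assms by (auto simp: face_sign_insert)
qed

lemma incidence_insert:
  assumes "w \<notin> B"
  shows "incidence pos (insert w B) B = face_sign w B"
proof -
  have "{v. v \<in> insert w B \<and> B = insert w B - {v}} = {w}"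
    using assms by auto
  moreover have "{u \<in> insert w B. pos u < pos w} = {u \<in> B. pos u < pos w}"
    by auto
  ultimately show ?thesis
    by (simp add: incidence_def face_sign_def)
qed

lemma incidence_eq_0:
  assumes "\<And>w. w \<notin> B \<Longrightarrow> A \<noteq> insert w B"
  shows "incidence pos A B = 0"
proof -
  have "\<not> (v \<in> A \<and> B = A - {v})" for v
    using assms[of v] by (auto simp: insert_absorb)
  then have "{v. v \<in> A \<and> B = A - {v}} = {}"
    by simp
  then show ?thesis
    unfolding incidence_def by (simp only: sum.empty)
qed

definition colour :: "'v \<Rightarrow> nat" where
  "colour x = (LEAST j. x \<in> S j)"

lemma colour_eq:
  assumes "x \<in> S j" "j < d"
  shows "colour x = j"
proof -
  have "x \<in> S (colour x)" "colour x \<le> j"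
    using assms(1) unfolding colour_def by (auto intro: LeastI Least_le)
  then show ?thesis
    using S_unique assms by (meson order_le_less_trans)
qed

definition inversions :: "'v set \<Rightarrow> ('v \<times> 'v) set" where
  "inversions A = {(x, y) \<in> A \<times> A. pos x < pos y \<and> colour y < colour x}"

text \<open>
  On a transversal this is the sign of the permutation between the order by \<^term>\<open>pos\<close> and the
  order by colour. With \<open>\<plusminus>m\<^sub>A\<close> signed in this way as the image of \<open>e\<^sub>A\<close>, the augmentation kills boundaries.
\<close>

definition orientation :: "'v set \<Rightarrow> int" where
  "orientation A = (-1) ^ card (inversions A)"

lemma orientation_square [simp]: "orientation A * orientation A = 1"
  by (simp add: orientation_def flip: power_add)

text \<open>A count modulo 2: the new inversions are \<open>P\<close> and \<open>Q\<close>, the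
  vertices before \<open>u\<close> are \<open>P\<close> and \<open>R\<close>, those of smaller
  colour are \<open>Q\<close> and \<open>R\<close>, and \<open>R\<close> is counted twice.\<close>

lemma orientation_insert:
  assumes "u \<notin> B" "\<And>x. x \<in> B \<Longrightarrow> colour x \<noteq> colour u"
  shows "orientation (insert u B) = orientation B * face_sign u B * (-1) ^ card {x \<in> B. colour x < colour u}"
proof -
  define P where "P = {x \<in> B. pos x < pos u \<and> colour u < colour x}"
  define Q where "Q = {x \<in> B. pos u < pos x \<and> colour x < colour u}"
  define R where "R = {x \<in> B. pos x < pos u \<and> colour x < colour u}"
  have pos: "pos x \<noteq> pos u" if "x \<in> B" for x
    using that assms(1) inj_pos by (metis inj_eq)
  have "inversions (insert u B) = inversions B \<union> ((\<lambda>x. (x, u)) ` P \<union> Pair u ` Q)"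
    by (auto simp: inversions_def P_def Q_def)
  moreover have "inversions B \<inter> ((\<lambda>x. (x, u)) ` P \<union> Pair u ` Q) = {}"
    "(\<lambda>x. (x, u)) ` P \<inter> Pair u ` Q = {}"
    using assms(1) by (auto simp: inversions_def P_def Q_def)
  moreover have "finite (inversions B)" "finite P" "finite Q"
    by auto
  ultimately have "card (inversions (insert u B)) = card (inversions B) + (card P + card Q)"
    by (simp add: card_Un_disjoint card_image inj_on_def)
  moreover have "{x \<in> B. pos x < pos u} = P \<union> R" "P \<inter> R = {}"
    using assms(2) by (auto simp: P_def R_def neq_iff)
  then have "card {x \<in> B. pos x < pos u} = card P + card R"
    by (simp add: card_Un_disjoint)
  moreover have "{x \<in> B. colour x < colour u} = Q \<union> R" "Q \<inter> R = {}"
    using pos by (auto simp: Q_def R_def neq_iff)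
  then have "card {x \<in> B. colour x < colour u} = card Q + card R"
    by (simp add: card_Un_disjoint)
  ultimately show ?thesis
    by (simp add: orientation_def face_sign_def power_add algebra_simps minus_one_power_iff)
qed

text \<open>For equal colours the colour count in \<open>orientation_insert\<close> is the same for
  \<open>u\<close> and \<open>v\<close>, so only \<open>face_sign_swap\<close> remains. This makes
  the two facets of a set with one doubled colour cancel under the augmentation.\<close>

lemma orientation_swap:
  assumes "u \<noteq> v" "u \<notin> B" "v \<notin> B" "colour u = colour v" "\<And>x. x \<in> B \<Longrightarrow> colour x \<noteq> colour v"
  shows "face_sign v (insert u B) * orientation (insert u B) =
    - (face_sign u (insert v B) * orientation (insert v B))"
proof -
  define r where "r = orientation B * (-1) ^ card {x \<in> B. colour x < colour v}"
  have "orientation (insert u B) = r * face_sign u B" "orientation (insert v B) = r * face_sign v B"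
    using orientation_insert[of u B] orientation_insert[of v B] assms by (simp_all add: r_def)
  then show ?thesis
    using face_sign_swap[OF assms(1-3)] by (simp add: algebra_simps)
qed

text \<open>The counterpart of \<open>cycle_constant\<close> for \<open>d + 1\<close> elements. The
  transversal \<open>C - {v}\<close> has one vertex per colour, so if \<open>v\<close> has a colour
  it doubles exactly one, that of \<open>u\<close>, and removing any vertex other than
  \<open>u\<close> and \<open>v\<close> loses a colour. If \<open>v\<close> has no colour, only its
  removal can leave a face.\<close>

lemma facet_pair:
  assumes C: "card C = d + 1" and v: "v \<in> C" "C - {v} \<in> faces"
  obtains "v \<notin> (\<Union>j<d. S j)" "\<And>w. w \<in> C \<Longrightarrow> C - {w} \<in> faces \<Longrightarrow> w = v"
  | u where "u \<in> C" "u \<noteq> v" "\<And>w. w \<in> C \<Longrightarrow> C - {w} \<in> faces \<Longrightarrow> w = v \<or> w = u"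
    "C - {u} \<in> faces \<longleftrightarrow> C \<in> faces"
    "face_sign v (C - {v}) * orientation (C - {v}) = - (face_sign u (C - {u}) * orientation (C - {u}))"
proof (cases "v \<in> (\<Union>j<d. S j)")
  case False
  then show ?thesis
    using that(1) faces_subset v(1) by blast
next
  case True
  then obtain j where j: "j < d" "v \<in> S j"
    by blast
  have "card (C - {v}) = d"
    using C v(1) by simp
  then have T: "transversal (C - {v})"
    using hits_card_eq faces_hits v(2) by blast
  obtain u where u: "u \<in> C - {v}" "u \<in> S j"
    using transversal_hits[OF T] j(1) unfolding hits_def by blast
  have two: "w = v \<or> w = u" if w: "w \<in> C" "C - {w} \<in> faces" for w
  proof (rule ccontr)
    assume *: "\<not> (w = v \<or> w = u)"
    obtain k where k: "k < d" "w \<in> S k"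
      using faces_subset[OF v(2), of w] w(1) * by blast
    obtain x where x: "x \<in> C" "x \<noteq> w" "x \<in> S k"
      using faces_hits[OF w(2)] k(1) unfolding hits_def by blast
    have "k \<noteq> j"
      using transversal_unique[OF T, of w u j] * k u w(1) j(1) by blast
    then have "x \<noteq> v"
      using S_unique x(3) j k(1) by blast
    then show False
      using transversal_unique[OF T, of w x k] * k x w(1) by blast
  qed
  \<comment> \<open>A transversal contains at most one of \<open>u\<close> and \<open>v\<close>,
    hence lies in one of the two facets.\<close>
  have iff: "C - {u} \<in> faces \<longleftrightarrow> C \<in> faces"
  proof
    assume Cu: "C - {u} \<in> faces"
    show "C \<in> faces"
    proof (rule facesI)
      show "\<exists>j<d. x \<in> S j" if "x \<in> C" for x
        using that faces_subset[OF v(2)] j by (cases "x = v") auto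
      show "hits C"
        by (rule hits_mono[OF faces_hits[OF v(2)]]) auto
      fix T' assume T': "transversal T'" "T' \<subseteq> C"
      have "\<not> (u \<in> T' \<and> v \<in> T')"
        using transversal_unique[OF T'(1), of u v j] u j by blast
      then have "T' \<subseteq> C - {u} \<or> T' \<subseteq> C - {v}"
        using T'(2) by blast
      then show "T' \<in> E"
        using faces_transversal[OF v(2) T'(1)] faces_transversal[OF Cu T'(1)] by blast
    qed
  next
    assume "C \<in> faces"
    moreover have "hits (insert v (C - {v} - {u}))"
      by (rule hits_exchange[OF T u(2) j(2) j(1)])
    moreover have "insert v (C - {v} - {u}) = C - {u}"
      using v(1) u(1) by blast
    ultimately show "C - {u} \<in> faces"
      using faces_down by (metis Diff_subset)
  qed
  define B where "B = C - {u, v}"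
  have B: "C - {v} = insert u B" "C - {u} = insert v B" "u \<notin> B" "v \<notin> B"
    using u v(1) by (auto simp: B_def)
  have "colour u = colour v"
    using colour_eq u(2) j by simp
  moreover have "colour x \<noteq> colour v" if x: "x \<in> B" for x
  proof -
    obtain k where k: "k < d" "x \<in> S k"
      using faces_subset[OF v(2), of x] x by (auto simp: B_def)
    moreover have "k \<noteq> j"
      using transversal_unique[OF T, of x u j] k u x j by (auto simp: B_def)
    ultimately show ?thesis
      using colour_eq j by simp
  qed
  ultimately have "face_sign v (C - {v}) * orientation (C - {v}) = - (face_sign u (C - {u}) * orientation (C - {u}))"
    unfolding B using orientation_swap B(3,4) u(1) by blast
  then show ?thesis
    using that(2)[of u] u(1) two iff by blast
qed

end

section \<open>The complex of a relative simplicial complex\<close>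

lemma (in monomial_ideal) ideal_zero: "0 \<in> I"
  unfolding I by (rule module.span_zero[OF module_mult])

lemma single_eq_0_iff [simp]: "single b x = 0 \<longleftrightarrow> x = 0"
  by (metis lookup_single_eq lookup_zero single_zero)

lemma sum_single: "(\<Sum>x\<in>A. single m (f x)) = single m (sum f A)"
  by (induction A rule: infinite_finite_induct) (simp_all add: single_add)

text \<open>Signs square to 1, so they can be cancelled over any commutative ring, also in
  characteristic 2, without case distinctions.\<close>

lemma mult_of_int_unit_eq_0:
  assumes "e * e = 1" "x * of_int e = (0 :: 'k::comm_ring_1)"
  shows "x = 0"
proof -
  have "of_int e * of_int e = (1 :: 'k)"
    using arg_cong[OF assms(1), of "of_int :: int \<Rightarrow> 'k"] by simp
  then show ?thesis
    using arg_cong[OF assms(2), of "\<lambda>y. y * of_int e"] by (simp add: mult.assoc)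
qed

lemma sum_count: "(\<Sum>v\<in>UNIV. int (count m v)) = int (size (m :: 'v::finite multiset))"
  using homogeneous_poly_degree[of "\<lambda>v. int (count m v)" "mon m :: ('v, int) mpoly" m]
  by (simp add: homogeneous_poly_def)

text \<open>The first two assumptions make the \<open>m_T\<close> with \<open>T\<close> a
  transversal in \<open>E\<close> exactly the monomials of degree \<open>d\<close> in
  \<open>I\<close>, which is what ties the simplicial side to the ideal.\<close>

locale linear_clutter = monomial_ideal I M + transversal_clutter d S E pos
  for I :: "('v::finite, 'k::comm_ring_1) mpoly set" and M
    and d :: nat and S :: "nat \<Rightarrow> 'v set" and E and pos +
  fixes X Y :: "'v set set"
  assumes ideal_degree: "mon m \<in> I \<Longrightarrow> size m = d \<Longrightarrow> \<exists>T\<in>E. transversal T \<and> m = mset_set T"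
    and ideal_edge: "transversal T \<Longrightarrow> T \<in> E \<Longrightarrow> mon (mset_set T) \<in> I"
    and XY: "X - Y = faces"
begin

abbreviation G :: "('v set, 'v, 'k) free_complex" where
  "G \<equiv> relative_free_complex pos (int d - 1) X Y"

abbreviation \<epsilon> :: "'v set \<Rightarrow> ('v, 'k) mpoly" where
  "\<epsilon> A \<equiv> single (mset_set A) (of_int (orientation A))"

abbreviation multideg :: "'v multiset \<Rightarrow> 'v \<Rightarrow> int" where
  "multideg m \<equiv> \<lambda>v. int (count m v)"

section \<open>Homogeneous chains in scalar coordinates\<close>

lemma basis_G: "basis G i = {A \<in> faces. int (card A) = i + int d}"
  by (auto simp: relative_free_complex_def XY)

lemma mdeg_G: "mdeg G i A = multideg (mset_set A)"
  by (simp add: relative_free_complex_def)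

lemma lookup_diff_G: "lookup (diff G i A) B =
    (if B \<in> faces then single (mset_set A - mset_set B) (of_int (incidence pos A B)) else 0)"
proof -
  have "lookup (diff G i A) B =
      (\<Sum>B'\<in>faces. if B' = B then single (mset_set A - mset_set B) (of_int (incidence pos A B)) else 0)"
    unfolding relative_free_complex_def XY
    by (simp add: lookup_sum lookup_single when_def cong: if_cong)
  then show ?thesis
    by simp
qed

lemma multideg_inject: "multideg m = multideg n \<Longrightarrow> m = n"
  by (auto simp: fun_eq_iff multiset_eq_iff)

lemma degree_form:
  assumes "z \<in> graded_part G i c" "lookup z A \<noteq> 0"
  obtains n where "A \<in> faces" "int (card A) = i + int d" "c = multideg (mset_set A + n)"
proof -
  have A: "A \<in> basis G i"
    using assms by (auto simp: graded_part_eq graded_piece_def free_module_iff)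
  obtain n where n: "n \<in> keys (lookup z A)"
    using assms(2) by fastforce
  have "homogeneous_poly (\<lambda>v. c v - multideg (mset_set A) v) (lookup z A)"
    using graded_piece_homogeneous[OF assms(1)[unfolded graded_part_eq], of A] by (simp add: mdeg_G)
  then have "int (count n v) = c v - int (count (mset_set A) v)" for v
    using n by (simp add: homogeneous_poly_def)
  then have "c = multideg (mset_set A + n)"
    by (auto simp: fun_eq_iff)
  then show ?thesis
    using that A by (auto simp: basis_G)
qed

text \<open>At \<open>A\<close>, an element of multidegree \<open>m\<close> is a scalar times
  \<open>m / m_A\<close>; \<open>coef\<close> is this scalar. The truncated subtraction is harmless:
  where \<open>m_A\<close> does not divide \<open>m\<close>, the coordinate is 0.\<close>

definition coef :: "'v multiset \<Rightarrow> ('v set \<Rightarrow>\<^sub>0 ('v, 'k) mpoly) \<Rightarrow> 'v set \<Rightarrow> 'k" where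
  "coef m z A = lookup (lookup z A) (m - mset_set A)"

lemma coef_nonzero:
  assumes "z \<in> graded_part G i (multideg m)" "coef m z A \<noteq> 0"
  shows "A \<in> faces" "int (card A) = i + int d" "mset_set A \<subseteq># m"
proof -
  have "lookup z A \<noteq> 0"
    using assms(2) by (auto simp: coef_def)
  then obtain n where n: "A \<in> faces" "int (card A) = i + int d" "multideg m = multideg (mset_set A + n)"
    by (rule degree_form[OF assms(1)])
  have "m = mset_set A + n"
    by (rule multideg_inject[OF n(3)])
  then show "A \<in> faces" "int (card A) = i + int d" "mset_set A \<subseteq># m"
    using n by simp_all
qed

lemma lookup_eq_coef:
  assumes z: "z \<in> graded_part G i (multideg m)"
  shows "lookup z A = single (m - mset_set A) (coef m z A)"
proof (cases "lookup z A = 0")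
  case False
  obtain n where "multideg m = multideg (mset_set A + n)"
    using degree_form[OF z False] by metis
  then have n: "m = mset_set A + n"
    by (rule multideg_inject)
  have "homogeneous_poly (\<lambda>v. multideg m v - multideg (mset_set A) v) (lookup z A)"
    using graded_piece_homogeneous[OF z[unfolded graded_part_eq], of A] by (simp add: mdeg_G)
  moreover have "(\<lambda>v. multideg m v - multideg (mset_set A) v) = multideg n"
    by (simp add: n)
  ultimately have "homogeneous_poly (multideg n) (lookup z A)"
    by simp
  then show ?thesis
  proof (cases rule: homogeneous_poly_cases)
    case (2 n' k)
    then have "n' = n"
      by (intro multideg_inject) auto
    then show ?thesis
      using 2 n by (simp add: coef_def)
  qed (use False in simp)
qed (simp add: coef_def)

lemma lookup_boundary_G:
  assumes z: "z \<in> graded_part G i (multideg m)" and B: "B \<in> faces"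
  shows "lookup (boundary G i z) B =
    single (m - mset_set B) (\<Sum>w\<in>-B. coef m z (insert w B) * of_int (face_sign w B))"
proof -
  define h where "h A = coef m z A * of_int (incidence pos A B)" for A
  \<comment> \<open>If \<open>h A\<close> is nonzero, \<open>m_B\<close> divides \<open>m_A\<close>
    and \<open>m_A\<close> divides \<open>m\<close>, and the quotients multiply to
    \<open>m / m_B\<close>. Otherwise the truncated differences need not add up, but both sides are
    0.\<close>
  have product: "lookup z A * lookup (diff G i A) B = single (m - mset_set B) (h A)" for A
  proof (cases "h A = 0")
    case True
    then show ?thesis
      using B by (simp add: lookup_diff_G lookup_eq_coef[OF z] mult_single h_def)
  next
    case False
    then have "incidence pos A B \<noteq> 0" "coef m z A \<noteq> 0"
      by (auto simp: h_def)
    then obtain w where w: "A = insert w B"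
      using incidence_eq_0[of B A] by blast
    have "mset_set A \<subseteq># m"
      by (rule coef_nonzero[OF z \<open>coef m z A \<noteq> 0\<close>])
    moreover have "mset_set B \<subseteq># mset_set A"
      using w by (simp add: subset_imp_msubset_mset_set subset_insertI)
    ultimately have "m - mset_set A + (mset_set A - mset_set B) = m - mset_set B"
      by (auto simp: multiset_eq_iff subseteq_mset_def)
    then show ?thesis
      using B by (simp add: lookup_diff_G lookup_eq_coef[OF z] mult_single h_def)
  qed
  have "lookup (boundary G i z) B = (\<Sum>A\<in>keys z. lookup z A * lookup (diff G i A) B)"
    by (simp add: boundary_def lookup_lin_ext augmentation_def)
  also have "\<dots> = (\<Sum>A\<in>UNIV. lookup z A * lookup (diff G i A) B)"
    by (rule sum.mono_neutral_left) (auto simp: in_keys_iff)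
  also have "\<dots> = single (m - mset_set B) (\<Sum>A\<in>UNIV. h A)"
    unfolding product sum_single ..
  also have "(\<Sum>A\<in>UNIV. h A) = (\<Sum>A\<in>(\<lambda>w. insert w B) ` (- B). h A)"
  proof (rule sum.mono_neutral_right)
    show "\<forall>A\<in>UNIV - (\<lambda>w. insert w B) ` (- B). h A = 0"
    proof
      fix A assume "A \<in> UNIV - (\<lambda>w. insert w B) ` (- B)"
      then have "incidence pos A B = 0"
        by (intro incidence_eq_0) auto
      then show "h A = 0"
        by (simp add: h_def)
    qed
  qed auto
  also have "\<dots> = (\<Sum>w\<in>-B. h (insert w B))"
    by (subst sum.reindex) (auto simp: inj_on_def)
  also have "\<dots> = (\<Sum>w\<in>-B. coef m z (insert w B) * of_int (face_sign w B))"
    by (intro sum.cong) (auto simp: h_def incidence_insert)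
  finally show ?thesis .
qed

lemma augmentation_G:
  assumes z: "z \<in> graded_part G i (multideg m)"
  shows "augmentation \<epsilon> z = single m (\<Sum>A\<in>UNIV. coef m z A * of_int (orientation A))"
proof -
  have product: "lookup z A * \<epsilon> A = single m (coef m z A * of_int (orientation A))" for A
  proof (cases "coef m z A = 0")
    case False
    then have "m - mset_set A + mset_set A = m"
      by (simp add: coef_nonzero(3)[OF z])
    then show ?thesis
      by (simp add: lookup_eq_coef[OF z] mult_single)
  qed (simp add: lookup_eq_coef[OF z])
  have "augmentation \<epsilon> z = (\<Sum>A\<in>UNIV. lookup z A * \<epsilon> A)"
    unfolding augmentation_def by (rule sum.mono_neutral_left) (auto simp: in_keys_iff)
  then show ?thesis
    unfolding product sum_single .
qed

lemma diff_G_graded: "A \<in> basis G i \<Longrightarrow> diff G i A \<in> graded_part G (i - 1) (mdeg G i A)"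
proof -
  assume A: "A \<in> basis G i"
  have *: "B \<in> basis G (i - 1) \<and> (\<forall>v. count (mset_set A - mset_set B) v = int (count (mset_set A) v) - int (count (mset_set B) v))"
    if "B \<in> faces" "incidence pos A B \<noteq> 0" for B
  proof -
    obtain w where w: "w \<notin> B" "A = insert w B"
      using incidence_eq_0[of B A] \<open>incidence pos A B \<noteq> 0\<close> by blast
    then show ?thesis
      using A that(1) by (auto simp: basis_G)
  qed
  show ?thesis
    unfolding graded_part_eq graded_piece_def
  proof (intro CollectI conjI ballI)
    show "diff G i A \<in> free_module (basis G (i - 1))"
      unfolding free_module_iff lookup_diff_G using * by (metis of_int_0 single_zero)
    show "homogeneous_poly (\<lambda>v. mdeg G i A v - mdeg G (i - 1) B v) (lookup (diff G i A) B)" for B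
      using *[of B] by (cases "incidence pos A B = 0")
        (auto simp: lookup_diff_G mdeg_G intro!: homogeneous_poly_single)
  qed
qed

lemma boundary_G_graded: "z \<in> graded_part G i c \<Longrightarrow> boundary G i z \<in> graded_part G (i - 1) c"
  unfolding graded_part_eq boundary_def
  using lin_ext_in_graded_piece[of "basis G i" "diff G i"] diff_G_graded unfolding graded_part_eq by blast

text \<open>No degree is left for a nonconstant coefficient, so each coordinate is a scalar, and the
  multidegree \<open>c\<close> itself names the only possible face.\<close>

lemma top_form:
  assumes y: "y \<in> graded_part G i c" and deg: "sum c UNIV = i + int d" and "y \<noteq> 0"
  obtains C k where "y = single C (single {#} k)" "k \<noteq> 0" "C \<in> faces" "int (card C) = i + int d"
    "c = multideg (mset_set C)"
proof -
  obtain C where C: "lookup y C \<noteq> 0"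
    using \<open>y \<noteq> 0\<close> by (metis lookup_zero poly_mapping_eqI)
  have c: "c = multideg (mset_set A) \<and> A \<in> faces \<and> int (card A) = i + int d" if A: "lookup y A \<noteq> 0" for A
  proof -
    obtain n where n: "A \<in> faces" "int (card A) = i + int d" "c = multideg (mset_set A + n)"
      using degree_form[OF y A] .
    then have "int (size (mset_set A + n)) = i + int d"
      using deg by (simp only: sum_count)
    then show ?thesis
      using n by simp
  qed
  have "A = C" if "lookup y A \<noteq> 0" for A
  proof -
    have "mset_set A = mset_set C"
      using c[OF that] c[OF C] by (intro multideg_inject) simp
    then show ?thesis
      by (metis finite finite_set_mset_mset_set)
  qed
  then have "y = single C (lookup y C)"
    by (intro poly_mapping_eqI) (metis lookup_single_eq lookup_single_not_eq)
  moreover have "lookup y C = single {#} (coef (mset_set C) y C)"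
    using lookup_eq_coef[of y i "mset_set C" C] y c[OF C] by simp
  ultimately show ?thesis
    using that[of C "coef (mset_set C) y C"] c[OF C] C by auto
qed

lemma top_graded:
  assumes "C \<in> faces" "int (card C) = i + int d"
  shows "single C (single {#} k) \<in> graded_part G i (multideg (mset_set C))"
  using assms by (auto simp: graded_part_eq graded_piece_def basis_G mdeg_G lookup_single when_def
      intro!: homogeneous_poly_single)

lemma lookup_boundary_top: "lookup (boundary G i (single C (single {#} k))) B =
    (if B \<in> faces then single (mset_set C - mset_set B) (k * of_int (incidence pos C B)) else 0)"
  by (simp add: boundary_def lookup_smult lookup_diff_G mult_single)

lemma coef_boundary_top: "coef (mset_set C) (boundary G i (single C (single {#} k))) B =
    (if B \<in> faces then k * of_int (incidence pos C B) else 0)"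
  by (simp add: coef_def lookup_boundary_top)

text \<open>A face with more than \<open>d\<close> vertices has one whose removal leaves a face;
  there the coefficient of the boundary is \<open>k\<close> up to sign.\<close>

lemma boundary_top_nonzero:
  assumes "C \<in> faces" "d < card C" "k \<noteq> 0"
  shows "boundary G i (single C (single {#} k)) \<noteq> 0"
proof -
  obtain w where w: "w \<in> C" "C - {w} \<in> faces"
    using faces_remove[OF assms(1,2)] .
  have "incidence pos C (C - {w}) = face_sign w (C - {w})"
    using incidence_insert[of w "C - {w}"] w(1) by (simp add: insert_absorb)
  moreover have "k * of_int (face_sign w (C - {w})) \<noteq> 0"
    using mult_of_int_unit_eq_0[OF face_sign_square] assms(3) by blast
  ultimately have "coef (mset_set C) (boundary G i (single C (single {#} k))) (C - {w}) \<noteq> 0"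
    using w(2) by (simp add: coef_boundary_top)
  then show ?thesis
    by (auto simp: coef_def)
qed

lemma mset_set_subseteq_iff: "mset_set A \<subseteq># mset_set B \<longleftrightarrow> A \<subseteq> (B :: 'v set)"
  using msubset_mset_set_iff[of A B] by simp

lemma Diff_singleton_of_card:
  assumes "A \<subseteq> (C :: 'v set)" "card C = card A + 1"
  obtains w where "w \<in> C" "A = C - {w}"
proof -
  have "card (C - A) = 1"
    using card_Diff_subset[of A C] assms by simp
  then obtain w where "C - A = {w}"
    by (rule card_1_singletonE)
  then show ?thesis
    using that[of w] assms(1) by blast
qed

section \<open>Cycles one degree above the generators\<close>

lemma cycle_coef_sum:
  assumes "z \<in> graded_part G i (multideg m)" "z \<in> cycles \<epsilon> G i" "i \<noteq> 0" "B \<in> faces"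
  shows "(\<Sum>w\<in>-B. coef m z (insert w B) * of_int (face_sign w B)) = 0"
proof -
  have "boundary G i z = 0"
    using assms(2,3) by (simp add: cycles_def)
  then have "single (m - mset_set B) (\<Sum>w\<in>-B. coef m z (insert w B) * of_int (face_sign w B)) = 0"
    using lookup_boundary_G[OF assms(1,4)] by simp
  then show ?thesis
    by (metis lookup_single_eq lookup_zero)
qed

lemma cycle_augmentation_sum:
  assumes "z \<in> graded_part G 0 (multideg m)" "z \<in> cycles \<epsilon> G 0"
  shows "(\<Sum>A\<in>UNIV. coef m z A * of_int (orientation A)) = 0"
proof -
  have "augmentation \<epsilon> z = 0"
    using assms(2) by (simp add: cycles_def)
  then have "single m (\<Sum>A\<in>UNIV. coef m z A * of_int (orientation A)) = 0"
    using augmentation_G[OF assms(1)] by simp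
  then show ?thesis
    by (metis lookup_single_eq lookup_zero)
qed

text \<open>If \<open>v\<close> were in \<open>A\<close>, the only set of the right size whose
  monomial divides \<open>m_A v\<close> would be \<open>A\<close>. Its coefficient would then be, up
  to sign, the whole augmentation, or the whole boundary coordinate at some facet
  \<open>A - {u}\<close>, and so vanish.\<close>

lemma cycle_squarefree:
  assumes z: "z \<in> graded_part G i (multideg (mset_set A + {#v#}))" and cyc: "z \<in> cycles \<epsilon> G i"
    and A: "coef (mset_set A + {#v#}) z A \<noteq> 0" and "i \<ge> 0"
  shows "v \<notin> A"
proof
  assume v: "v \<in> A"
  let ?m = "mset_set A + {#v#}"
  have face: "A \<in> faces" "int (card A) = i + int d"
    using coef_nonzero[OF z A] by blast+
  have only: "coef ?m z A' = 0" if "A' \<noteq> A" for A'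
  proof (rule ccontr)
    assume "coef ?m z A' \<noteq> 0"
    then have A': "int (card A') = i + int d" "mset_set A' \<subseteq># ?m"
      using coef_nonzero[OF z] by blast+
    have "A' \<subseteq> A"
      using set_mset_mono[OF A'(2)] v by auto
    then show False
      using A'(1) face(2) that by (simp add: card_subset_eq)
  qed
  show False
  proof (cases "i = 0")
    case True
    have "(\<Sum>A'\<in>UNIV. coef ?m z A' * of_int (orientation A')) =
        (\<Sum>A'\<in>{A}. coef ?m z A' * of_int (orientation A'))"
      by (rule sum.mono_neutral_right) (use only in simp_all)
    then have "coef ?m z A * of_int (orientation A) = 0"
      using cycle_augmentation_sum[of z ?m] z cyc True by simp
    then show False
      using mult_of_int_unit_eq_0[OF orientation_square] A by blast
  next
    case False
    have "d < card A"
      using face(2) \<open>i \<ge> 0\<close> False by linarith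
    then obtain u where u: "u \<in> A" "A - {u} \<in> faces"
      by (rule faces_remove[OF face(1)])
    let ?B = "A - {u}"
    have "(\<Sum>w\<in>-?B. coef ?m z (insert w ?B) * of_int (face_sign w ?B)) =
        (\<Sum>w\<in>{u}. coef ?m z (insert w ?B) * of_int (face_sign w ?B))"
    proof (rule sum.mono_neutral_right)
      show "\<forall>w\<in>- ?B - {u}. coef ?m z (insert w ?B) * of_int (face_sign w ?B) = 0"
      proof
        fix w assume "w \<in> - ?B - {u}"
        then have "insert w ?B \<noteq> A"
          using u(1) by blast
        then show "coef ?m z (insert w ?B) * of_int (face_sign w ?B) = 0"
          by (metis only mult_zero_left)
      qed
    qed auto
    then have "coef ?m z A * of_int (face_sign u ?B) = 0"
      using cycle_coef_sum[OF z cyc False u(2)] u(1) by (simp add: insert_absorb)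
    then show False
      using mult_of_int_unit_eq_0[OF face_sign_square] A by blast
  qed
qed

lemma cycle_form:
  assumes z: "z \<in> graded_part G i c" and cyc: "z \<in> cycles \<epsilon> G i" and "z \<noteq> 0"
    and deg: "sum c UNIV = i + 1 + int d" and "i \<ge> 0"
  obtains C k where "C \<in> faces" "int (card C) = i + 1 + int d" "c = multideg (mset_set C)"
    "z = boundary G (i + 1) (single C (single {#} k))"
proof -
  obtain A where A: "lookup z A \<noteq> 0"
    using \<open>z \<noteq> 0\<close> by (metis lookup_zero poly_mapping_eqI)
  obtain n where n: "A \<in> faces" "int (card A) = i + int d" "c = multideg (mset_set A + n)"
    using degree_form[OF z A] .
  have "int (size (mset_set A + n)) = i + 1 + int d"
    using deg unfolding n(3) by (simp only: sum_count)
  then have "size n = 1"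
    using n(2) by simp
  then obtain v where v: "n = {#v#}"
    using size_1_singleton_mset by blast
  have z': "z \<in> graded_part G i (multideg (mset_set A + {#v#}))"
    using z n(3) v by simp
  have "coef (mset_set A + {#v#}) z A \<noteq> 0"
    using A lookup_eq_coef[OF z', of A] by auto
  then have vA: "v \<notin> A"
    using cycle_squarefree[OF z' cyc] \<open>i \<ge> 0\<close> by blast
  define C where "C = insert v A"
  define m where "m = mset_set C"
  have m: "m = mset_set A + {#v#}"
    using vA by (simp add: m_def C_def)
  have C: "card C = card A + 1" "v \<in> C" "C - {v} = A"
    using vA by (auto simp: C_def)
  have zm: "z \<in> graded_part G i (multideg m)"
    using z' m by simp
  have supp: "\<exists>w\<in>C. A' = C - {w} \<and> A' \<in> faces" if "coef m z A' \<noteq> 0" for A'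
  proof -
    have A': "A' \<in> faces" "int (card A') = i + int d" "A' \<subseteq> C"
      using coef_nonzero[OF zm that] by (auto simp: m_def mset_set_subseteq_iff)
    then show ?thesis
      using Diff_singleton_of_card[OF A'(3)] C(1) n(2) by auto
  qed
  \<comment> \<open>This divides out the incidence sign: \<open>z\<close> is a multiple of the
    relative boundary of \<open>C\<close> when \<open>\<kappa>\<close> is constant on the vertices
    whose removal leaves a face.\<close>
  define \<kappa> where "\<kappa> w = coef m z (C - {w}) * of_int (face_sign w (C - {w}))" for w
  have coef_\<kappa>: "coef m z (C - {w}) = \<kappa> w * of_int (face_sign w (C - {w}))" for w
    by (simp add: \<kappa>_def mult.assoc flip: of_int_mult)
  have \<kappa>_zero: "\<kappa> w = 0" if "C - {w} \<notin> faces" for w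
  proof -
    have "coef m z (C - {w}) = 0"
      using supp[of "C - {w}"] that by metis
    then show ?thesis
      by (simp add: \<kappa>_def)
  qed
  have \<kappa>v: "\<kappa> v \<noteq> 0"
    using mult_of_int_unit_eq_0[OF face_sign_square] A lookup_eq_coef[OF zm, of A] by (auto simp: \<kappa>_def C(3))
  have main: "C \<in> faces \<and> (\<forall>w\<in>C. C - {w} \<in> faces \<longrightarrow> \<kappa> w = \<kappa> v)"
  proof (cases "i = 0")
    case True
    have sum0: "(\<Sum>A\<in>UNIV. coef m z A * of_int (orientation A)) = 0"
      using cycle_augmentation_sum zm cyc True by blast
    have "card C = d + 1"
      using C(1) n(2) True by simp
    moreover have "C - {v} \<in> faces"
      using C(3) n(1) by simp
    ultimately show ?thesis
    proof (rule facet_pair[OF _ C(2)])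
      \<comment> \<open>With a single facet the augmentation has only one term, which is nonzero;
        the case is contradictory.\<close>
      assume only: "\<And>w. w \<in> C \<Longrightarrow> C - {w} \<in> faces \<Longrightarrow> w = v"
      have "coef m z A = 0" if "A \<noteq> C - {v}" for A
        using supp[of A] only that by blast
      then have "(\<Sum>A\<in>UNIV. coef m z A * of_int (orientation A)) =
          (\<Sum>A\<in>{C - {v}}. coef m z A * of_int (orientation A))"
        by (intro sum.mono_neutral_right) simp_all
      then have "coef m z (C - {v}) * of_int (orientation (C - {v})) = 0"
        using sum0 by simp
      then have "coef m z (C - {v}) = 0"
        by (rule mult_of_int_unit_eq_0[OF orientation_square])
      then show ?thesis
        using \<kappa>v by (simp add: \<kappa>_def)
    next
      fix u assume u: "u \<in> C" "u \<noteq> v" and only: "\<And>w. w \<in> C \<Longrightarrow> C - {w} \<in> faces \<Longrightarrow> w = v \<or> w = u"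
        and iff: "C - {u} \<in> faces \<longleftrightarrow> C \<in> faces"
        and eq: "face_sign v (C - {v}) * orientation (C - {v}) = - (face_sign u (C - {u}) * orientation (C - {u}))"
      define e where "e w = face_sign w (C - {w}) * orientation (C - {w})" for w
      have ne: "C - {v} \<noteq> C - {u}"
        using u C(2) by blast
      have "coef m z A = 0" if "A \<noteq> C - {v}" "A \<noteq> C - {u}" for A
        using supp[of A] only that by blast
      then have "(\<Sum>A\<in>UNIV. coef m z A * of_int (orientation A)) =
          (\<Sum>A\<in>{C - {v}, C - {u}}. coef m z A * of_int (orientation A))"
        by (intro sum.mono_neutral_right) simp_all
      then have "\<kappa> v * of_int (e v) + \<kappa> u * of_int (e u) = 0"
        using sum0 ne by (simp add: coef_\<kappa> e_def mult.assoc)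
      moreover have "e v = - e u"
        using eq by (simp add: e_def)
      ultimately have "(\<kappa> u - \<kappa> v) * of_int (e u) = 0"
        by (simp add: algebra_simps)
      moreover have "e u * e u = 1"
        by (simp add: e_def mult.assoc mult.left_commute[of "orientation _"])
      ultimately have "\<kappa> u = \<kappa> v"
        using mult_of_int_unit_eq_0[of "e u" "\<kappa> u - \<kappa> v"] by simp
      \<comment> \<open>Since \<open>\<kappa> u = \<kappa> v\<close> is nonzero,
        \<open>C - {u}\<close> is a face by \<open>\<kappa>_zero\<close>, and then so is
        \<open>C\<close>.\<close>
      then show ?thesis
        using \<kappa>_zero[of u] \<kappa>v iff only by metis
    qed
  next
    case False
    \<comment> \<open>The boundary coordinate at \<open>B = C - {u, w}\<close> involves only the two
      sets strictly between \<open>B\<close> and \<open>C\<close>; by \<open>face_sign_swap\<close>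
      they contribute \<open>\<kappa> u\<close> and \<open>\<kappa> w\<close> with opposite
      signs.\<close>
    have eq: "\<kappa> u = \<kappa> w" if uw: "u \<in> C" "w \<in> C" "u \<noteq> w" "C - {u, w} \<in> faces" for u w
    proof -
      define B where "B = C - {u, w}"
      have B: "C - {w} = insert u B" "C - {u} = insert w B" "u \<notin> B" "w \<notin> B"
        using uw by (auto simp: B_def)
      have "(\<Sum>x\<in>-B. coef m z (insert x B) * of_int (face_sign x B)) =
          (\<Sum>x\<in>{u, w}. coef m z (insert x B) * of_int (face_sign x B))"
      proof (rule sum.mono_neutral_right)
        show "\<forall>x\<in>- B - {u, w}. coef m z (insert x B) * of_int (face_sign x B) = 0"
        proof
          fix x assume x: "x \<in> - B - {u, w}"
          then have "x \<notin> C"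
            by (auto simp: B_def)
          then have "coef m z (insert x B) = 0"
            using supp[of "insert x B"] by blast
          then show "coef m z (insert x B) * of_int (face_sign x B) = 0"
            by simp
        qed
      qed (use B in auto)
      then have sum0: "coef m z (insert u B) * of_int (face_sign u B) + coef m z (insert w B) * of_int (face_sign w B) = 0"
        using cycle_coef_sum[OF zm cyc False uw(4)] uw(3) by (simp flip: B_def)
      define e where "e = face_sign u (insert w B) * face_sign w B"
      have e: "face_sign w (insert u B) * face_sign u B = - e"
        unfolding e_def by (rule face_sign_swap[OF uw(3) B(3,4)])
      have "coef m z (insert u B) * of_int (face_sign u B) = \<kappa> w * of_int (- e)"
        unfolding e[symmetric] using coef_\<kappa>[of w] by (simp add: B(1) mult.assoc)
      moreover have "coef m z (insert w B) * of_int (face_sign w B) = \<kappa> u * of_int e"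
        unfolding e_def using coef_\<kappa>[of u] by (simp add: B(2) mult.assoc)
      ultimately have "(\<kappa> u - \<kappa> w) * of_int e = 0"
        using sum0 by (simp add: algebra_simps)
      moreover have "e * e = 1"
        by (simp add: e_def mult.assoc mult.left_commute[of "face_sign w B"])
      ultimately show ?thesis
        using mult_of_int_unit_eq_0[of e "\<kappa> u - \<kappa> w"] by simp
    qed
    have "d + 2 \<le> card C"
      using C(1) n(2) False \<open>i \<ge> 0\<close> by linarith
    then show ?thesis
      using cycle_constant[of C \<kappa> v] eq \<kappa>_zero C(2) \<kappa>v by metis
  qed
  have "z = boundary G (i + 1) (single C (single {#} (\<kappa> v)))"
  proof (rule poly_mapping_eqI)
    fix B
    have "coef m z B = (if B \<in> faces then \<kappa> v * of_int (incidence pos C B) else 0)"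
    proof (cases "\<exists>w\<in>C. B = C - {w}")
      case True
      then obtain w where w: "w \<in> C" "B = C - {w}"
        by blast
      then have "incidence pos C B = face_sign w B"
        using incidence_insert[of w B] by (simp add: insert_absorb)
      then show ?thesis
        using w main coef_\<kappa>[of w] \<kappa>_zero[of w] by auto
    next
      case False
      then have "incidence pos C B = 0"
        by (intro incidence_eq_0) auto
      moreover have "coef m z B = 0"
        using supp False by blast
      ultimately show ?thesis
        by simp
    qed
    then show "lookup z B = lookup (boundary G (i + 1) (single C (single {#} (\<kappa> v)))) B"
      unfolding lookup_boundary_top lookup_eq_coef[OF zm] by (simp add: m_def)
  qed
  moreover have "c = multideg (mset_set C)"
    using n(3) m by (simp add: v m_def)
  moreover have "int (card C) = i + 1 + int d"
    using C(1) n(2) by simp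
  ultimately show ?thesis
    using that main by blast
qed

text \<open>In homological degree 0 being a cycle means that the augmentation vanishes, and there
  the two facets from \<open>facet_pair\<close> cancel by their orientations; in positive degrees it
  is the usual cancellation in the squared boundary.\<close>

lemma boundary_top_cycle:
  assumes C: "C \<in> faces" "int (card C) = i + 1 + int d" and "i \<ge> 0"
  shows "boundary G (i + 1) (single C (single {#} k)) \<in> cycles \<epsilon> G i"
proof -
  define z where "z = boundary G (i + 1) (single C (single {#} k))"
  define m where "m = mset_set C"
  have z: "z \<in> graded_part G i (multideg m)"
    using boundary_G_graded[OF top_graded[of C "i + 1" k]] C by (simp add: z_def m_def)
  have coef: "coef m z B = (if B \<in> faces then k * of_int (incidence pos C B) else 0)" for B
    by (simp add: m_def z_def coef_boundary_top)
  have supp: "\<exists>w\<in>C. B = C - {w}" "B \<in> faces" if "coef m z B \<noteq> 0" for B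
  proof -
    show "B \<in> faces"
      using that by (simp add: coef split: if_splits)
    have "incidence pos C B \<noteq> 0"
      using that unfolding coef by (metis mult_zero_right of_int_0)
    then obtain w where "w \<notin> B" "C = insert w B"
      using incidence_eq_0 by blast
    then show "\<exists>w\<in>C. B = C - {w}"
      by blast
  qed
  have coef_sign: "coef m z (C - {w}) = k * of_int (face_sign w (C - {w}))" if "w \<in> C" "C - {w} \<in> faces" for w
    using that incidence_insert[of w "C - {w}"] by (simp add: coef insert_absorb)
  have "augmentation \<epsilon> z = 0" if "i = 0"
  proof -
    have dC: "card C = d + 1"
      using C(2) that by simp
    then have "d < card C"
      by simp
    then obtain v where v: "v \<in> C" "C - {v} \<in> faces"
      by (rule faces_remove[OF C(1)])
    have "(\<Sum>A\<in>UNIV. coef m z A * of_int (orientation A)) = 0"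
      using dC v
    proof (rule facet_pair)
      assume "v \<notin> (\<Union>j<d. S j)"
      then show ?thesis
        using faces_subset[OF C(1) v(1)] by blast
    next
      fix u assume u: "u \<in> C" "u \<noteq> v" and only: "\<And>w. w \<in> C \<Longrightarrow> C - {w} \<in> faces \<Longrightarrow> w = v \<or> w = u"
        and iff: "C - {u} \<in> faces \<longleftrightarrow> C \<in> faces"
        and eq: "face_sign v (C - {v}) * orientation (C - {v}) = - (face_sign u (C - {u}) * orientation (C - {u}))"
      have ne: "C - {v} \<noteq> C - {u}"
        using u v(1) by blast
      have "coef m z A = 0" if "A \<noteq> C - {v}" "A \<noteq> C - {u}" for A
        using supp[of A] only that by blast
      then have "(\<Sum>A\<in>UNIV. coef m z A * of_int (orientation A)) =
          (\<Sum>A\<in>{C - {v}, C - {u}}. coef m z A * of_int (orientation A))"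
        by (intro sum.mono_neutral_right) simp_all
      also have "\<dots> = k * of_int (face_sign v (C - {v}) * orientation (C - {v}) + face_sign u (C - {u}) * orientation (C - {u}))"
        using ne coef_sign[OF v] coef_sign[OF u(1)] iff C(1) by (simp add: algebra_simps)
      finally show ?thesis
        by (simp add: eq)
    qed
    then show ?thesis
      using augmentation_G[OF z] by simp
  qed
  moreover have "boundary G i z = 0"
  proof (rule poly_mapping_eqI)
    fix B
    have "lookup (boundary G i z) B = 0"
    proof (cases "B \<in> faces")
      case True
      have "(\<Sum>x\<in>-B. coef m z (insert x B) * of_int (face_sign x B)) = 0"
      proof (cases "\<exists>u w. u \<noteq> w \<and> u \<notin> B \<and> w \<notin> B \<and> C = insert u (insert w B)")
        case True
        then obtain u w where uw: "u \<noteq> w" "u \<notin> B" "w \<notin> B" "C = insert u (insert w B)"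
          by blast
        have C_minus: "C - {w} = insert u B" "C - {u} = insert w B"
          using uw by auto
        \<comment> \<open>The relative boundary squares to zero because \<open>faces\<close>
          contains every set between two of its members: both intermediate sets contain
          \<open>B\<close> and so meet all colour classes.\<close>
        then have faces: "C - {w} \<in> faces" "C - {u} \<in> faces"
          using uw(4) hits_mono[OF faces_hits[OF \<open>B \<in> faces\<close>]] faces_down[OF C(1)] by (metis Diff_subset subset_insertI)+
        have "(\<Sum>x\<in>-B. coef m z (insert x B) * of_int (face_sign x B)) =
            (\<Sum>x\<in>{u, w}. coef m z (insert x B) * of_int (face_sign x B))"
        proof (rule sum.mono_neutral_right)
          show "\<forall>x\<in>- B - {u, w}. coef m z (insert x B) * of_int (face_sign x B) = 0"
          proof
            fix x assume x: "x \<in> - B - {u, w}"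
            then have "x \<notin> C"
              using uw(4) by blast
            then have "coef m z (insert x B) = 0"
              using supp(1)[of "insert x B"] by blast
            then show "coef m z (insert x B) * of_int (face_sign x B) = 0"
              by simp
          qed
        qed (use uw in auto)
        also have "\<dots> = k * of_int (face_sign w (insert u B) * face_sign u B + face_sign u (insert w B) * face_sign w B)"
          using uw(1,4) coef_sign[of w] coef_sign[of u] faces unfolding C_minus by (simp add: algebra_simps)
        finally show ?thesis
          using face_sign_swap[OF uw(1-3)] by simp
      next
        case False
        have "coef m z (insert x B) = 0" if x: "x \<in> - B" for x
        proof (rule ccontr)
          assume "coef m z (insert x B) \<noteq> 0"
          then obtain w where "w \<in> C" "insert x B = C - {w}"
            using supp(1) by blast
          then have "w \<noteq> x" "w \<notin> B" "C = insert w (insert x B)"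
            by blast+
          then show False
            using False x by blast
        qed
        then show ?thesis
          by simp
      qed
      then show ?thesis
        using lookup_boundary_G[OF z True] by simp
    next
      case False
      have "boundary G i z \<in> graded_part G (i - 1) (multideg m)"
        by (rule boundary_G_graded[OF z])
      then show ?thesis
        using degree_form[of "boundary G i z" "i - 1" "multideg m" B] False by blast
    qed
    then show "lookup (boundary G i z) B = lookup 0 B"
      by simp
  qed
  moreover have "z \<in> chain_module G i"
    using z by (simp add: graded_part_def)
  ultimately show ?thesis
    unfolding z_def[symmetric] by (simp add: cycles_def)
qed

theorem relative_complex_presentation: "linear_presentation (int d) I G \<epsilon>"
  unfolding linear_presentation_def
proof (intro conjI allI impI ballI)
  \<comment> \<open>A face meets \<open>d\<close> disjoint classes, hence has at least
    \<open>d\<close> vertices.\<close>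
  show "basis G i = {}" if "i < 0" for i
    using hits_card_le[OF faces_hits] that by (force simp: basis_G)
  show "sum (mdeg G i A) UNIV = i + int d" if "A \<in> basis G i" for i A
    using that unfolding mdeg_G sum_count by (simp add: basis_G)
  show "diff G i A \<in> graded_part G (i - 1) (mdeg G i A)" if "A \<in> basis G i" for i A
    by (rule diff_G_graded[OF that])
next
  fix c :: "'v \<Rightarrow> int" assume c: "sum c UNIV = int d"
  show "bij_betw (augmentation \<epsilon>) (graded_part G 0 c) {p \<in> I. homogeneous_poly c p}"
    unfolding bij_betw_def
  proof (intro conjI equalityI inj_onI subsetI)
    fix f g assume fg: "f \<in> graded_part G 0 c" "g \<in> graded_part G 0 c" "augmentation \<epsilon> f = augmentation \<epsilon> g"
    have 0: "augmentation \<epsilon> (f - g) = 0"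
      using fg(3) module_hom.diff[OF augmentation_hom, of \<epsilon> f g] by simp
    show "f = g"
    proof (rule ccontr)
      assume "f \<noteq> g"
      then have "f - g \<noteq> 0"
        by simp
      moreover have "sum c UNIV = 0 + int d"
        using c by simp
      ultimately obtain C k where Ck: "f - g = single C (single {#} k)" "k \<noteq> 0"
        using top_form[OF graded_part_diff[OF fg(1,2)]] by metis
      have "k * of_int (orientation C) \<noteq> 0"
        using mult_of_int_unit_eq_0[OF orientation_square] Ck(2) by blast
      moreover have "single (mset_set C) (k * of_int (orientation C)) = 0"
        using 0 by (simp add: Ck(1) mult_single)
      ultimately show False
        by (metis lookup_single_eq lookup_zero)
    qed
  next
    fix p assume "p \<in> augmentation \<epsilon> ` graded_part G 0 c"
    then obtain f where f: "f \<in> graded_part G 0 c" "p = augmentation \<epsilon> f"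
      by blast
    show "p \<in> {p \<in> I. homogeneous_poly c p}"
    proof (cases "f = 0")
      case True
      then show ?thesis
        using ideal_zero by (simp add: f(2) augmentation_0)
    next
      case False
      then obtain C k where Ck: "f = single C (single {#} k)" "C \<in> faces" "int (card C) = 0 + int d"
          "c = multideg (mset_set C)"
        using top_form[OF f(1)] c by (metis add_0)
      have C: "transversal C"
        using hits_card_eq[OF faces_hits[OF Ck(2)]] Ck(3) by simp
      then have "mon (mset_set C) \<in> I"
        using ideal_edge faces_transversal[OF Ck(2)] by blast
      then show ?thesis
        using single_in_ideal by (simp add: f(2) Ck(1,4) mult_single homogeneous_poly_single)
    qed
  next
    fix p assume p: "p \<in> {p \<in> I. homogeneous_poly c p}"
    then have hom: "homogeneous_poly c p" and pI: "p \<in> I"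
      by auto
    from hom show "p \<in> augmentation \<epsilon> ` graded_part G 0 c"
    proof (cases rule: homogeneous_poly_cases)
      case 1
      then show ?thesis
        by (intro image_eqI[of _ _ 0]) (simp_all add: augmentation_0 graded_part_eq)
    next
      case (2 m k)
      have cm: "c = multideg m"
        using 2 by auto
      have "size m = d"
        using c unfolding cm sum_count by simp
      moreover have "mon m \<in> I"
        using mon_in_ideal[OF pI, of m] 2 by simp
      ultimately obtain T where T: "T \<in> E" "transversal T" "m = mset_set T"
        using ideal_degree by blast
      \<comment> \<open>The only transversal inside \<open>T\<close> is \<open>T\<close> itself, by
        cardinality.\<close>
      have face: "T \<in> faces"
      proof (rule facesI)
        show "\<exists>j<d. x \<in> S j" if "x \<in> T" for x
          using that T(2) by (auto simp: transversal_def)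
        show "hits T"
          by (rule transversal_hits[OF T(2)])
        show "T' \<in> E" if "transversal T'" "T' \<subseteq> T" for T'
          using that T(1,2) transversal_card by (metis card_subset_eq finite)
      qed
      \<comment> \<open>The factor \<open>orientation T\<close> cancels the sign that
        \<open>\<epsilon>\<close> puts on \<open>m_T\<close>.\<close>
      define y :: "'v set \<Rightarrow>\<^sub>0 ('v, 'k) mpoly" where "y = single T (single {#} (k * of_int (orientation T)))"
      have "y \<in> graded_part G 0 c"
        using top_graded[OF face, of 0] transversal_card[OF T(2)] by (simp add: y_def cm T(3))
      moreover have "augmentation \<epsilon> y = p"
        by (simp add: y_def mult_single 2 T(3) mult.assoc flip: of_int_mult)
      ultimately show ?thesis
        by blast
    qed
  qed
next
  fix i and c :: "'v \<Rightarrow> int" assume i: "0 \<le> i" and c: "sum c UNIV = i + 1 + int d"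
  show "bij_betw (boundary G (i + 1)) (graded_part G (i + 1) c) (graded_part G i c \<inter> cycles \<epsilon> G i)"
    unfolding bij_betw_def
  proof (intro conjI equalityI inj_onI subsetI)
    fix f g assume fg: "f \<in> graded_part G (i + 1) c" "g \<in> graded_part G (i + 1) c"
      "boundary G (i + 1) f = boundary G (i + 1) g"
    have 0: "boundary G (i + 1) (f - g) = 0"
      using fg(3) module_hom.diff[OF lin_ext_hom, of "diff G (i + 1)" f g] by (simp add: boundary_def)
    show "f = g"
    proof (rule ccontr)
      assume "f \<noteq> g"
      then have "f - g \<noteq> 0"
        by simp
      then obtain C k where Ck: "f - g = single C (single {#} k)" "k \<noteq> 0" "C \<in> faces"
          "int (card C) = i + 1 + int d"
        using top_form[OF graded_part_diff[OF fg(1,2)] c] by metis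
      then show False
        using boundary_top_nonzero[OF Ck(3) _ Ck(2), of "i + 1"] 0 i by simp
    qed
  next
    fix z assume "z \<in> boundary G (i + 1) ` graded_part G (i + 1) c"
    then obtain f where f: "f \<in> graded_part G (i + 1) c" "z = boundary G (i + 1) f"
      by blast
    have zg: "z \<in> graded_part G i c"
      using boundary_G_graded[OF f(1)] f(2) by simp
    moreover have "z \<in> cycles \<epsilon> G i"
    proof (cases "f = 0")
      case True
      then have "z = 0"
        by (simp add: f(2) boundary_def lin_ext_0)
      then show ?thesis
        by (simp add: cycles_def chain_module_def boundary_def lin_ext_0 augmentation_0)
    next
      case False
      then obtain C k where "f = single C (single {#} k)" "C \<in> faces" "int (card C) = i + 1 + int d"
        using top_form[OF f(1) c] by metis
      then show ?thesis
        using boundary_top_cycle[OF _ _ i] f(2) by blast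
    qed
    ultimately show "z \<in> graded_part G i c \<inter> cycles \<epsilon> G i"
      by blast
  next
    fix z assume z: "z \<in> graded_part G i c \<inter> cycles \<epsilon> G i"
    show "z \<in> boundary G (i + 1) ` graded_part G (i + 1) c"
    proof (cases "z = 0")
      case True
      then show ?thesis
        by (intro image_eqI[of _ _ 0]) (simp_all add: boundary_def lin_ext_0 graded_part_eq)
    next
      case False
      obtain C k where C: "C \<in> faces" "int (card C) = i + 1 + int d" "c = multideg (mset_set C)"
        and "z = boundary G (i + 1) (single C (single {#} k))"
        using cycle_form[OF IntD1[OF z] IntD2[OF z] False c i] .
      moreover have "single C (single {#} k) \<in> graded_part G (i + 1) c"
        using top_graded[OF C(1,2)] C(3) by simp
      ultimately show ?thesis
        by blast
    qed
  qed
qed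

end

section \<open>Admissible regular sequences\<close>

lemma squarefree_eq_mset_set:
  assumes "squarefree_mon m"
  shows "mset_set (set_mset m) = m"
proof (rule multiset_eqI)
  fix v
  have "count m v \<le> 1"
    using assms by (simp add: squarefree_mon_def)
  then show "count (mset_set (set_mset m)) v = count m v"
    using count_greater_zero_iff[of m v]
    by (cases "count m v") (auto simp: not_in_iff simp del: count_greater_zero_iff)
qed

theorem theorem3p8:
  fixes I :: "('v::finite, 'k::field) mpoly set"
    and as :: "'v multiset list"
    and F :: "('b, 'v, 'k) free_complex"
    and \<epsilon> :: "'b \<Rightarrow> ('v, 'k) mpoly"
    and pos :: "'v \<Rightarrow> nat"
  assumes "squarefree_monomial_ideal I"
    and "I \<noteq> {0}" and "I \<noteq> UNIV"
    and "admissible_regular_sequence I as"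
    and "minimal_free_resolution I F \<epsilon>"
    and "inj pos"
  shows "complex_isomorphic
           (relative_free_complex pos (int (initial_degree I) - 1) (X_complex I as) (Y_complex I as))
           (first_linear_strand F)"
proof -
  obtain M where M: "\<And>m. m \<in> M \<Longrightarrow> squarefree_mon m" "I = ideal_span (mon ` M)"
    using assms(1) unfolding squarefree_monomial_ideal_def by blast
  define d where "d = initial_degree I"
  define S where "S j = set_mset (as ! j)" for j
  have d: "d = length as"
    using assms(4) by (simp add: admissible_regular_sequence_def d_def)
  interpret monomial_resolution I M F \<epsilon>
    by unfold_locales (fact M(2) assms(5) assms(2))+
  interpret transversal_clutter d S "clutter_edges I" pos
  proof
    show "S i \<inter> S j = {}" if "i < d" "j < d" "i \<noteq> j" for i j
    proof -
      have "as ! i \<inter># as ! j = {#}"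
        using assms(4) that by (simp add: admissible_regular_sequence_def d)
      then show ?thesis
        by (metis S_def set_mset_empty set_mset_inter)
    qed
  qed (fact assms(6))
  \<comment> \<open>A minimal generator is divisible by a squarefree member of \<open>M\<close> and
    must be equal to it.\<close>
  have sqf: "mset_set (set_mset m) = m" if m: "m \<in> min_gens I" for m
  proof -
    obtain n where n: "n \<in> M" "n \<subseteq># m"
      using m by (auto simp: min_gens_def M(2) mon_in_span_iff)
    then have "mon n \<in> I"
      unfolding M(2) mon_in_span_iff by blast
    then have "n = m"
      using m n(2) by (simp add: min_gens_def)
    then show ?thesis
      using n(1) M(1) squarefree_eq_mset_set by blast
  qed
  \<comment> \<open>Some generator of the Alexander dual divides \<open>a_j\<close> and shares a
    variable with \<open>n\<close>, so \<open>a_j\<close> shares one too.\<close>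
  have meets: "hits (set_mset n)" if n: "mon n \<in> I" for n
    unfolding hits_def
  proof (intro allI impI)
    fix j assume "j < d"
    then have "mon (as ! j) \<in> alexander_dual I"
      using assms(4) by (simp add: admissible_regular_sequence_def d)
    then obtain m where m: "m \<inter># n \<noteq> {#}" "m \<subseteq># as ! j"
      using n unfolding alexander_dual_def mon_in_span_iff by blast
    obtain x where "x \<in># m \<inter># n"
      using m(1) by blast
    then have "x \<in> set_mset n \<inter> S j"
      using mset_subset_eqD[OF m(2)] by (auto simp: S_def)
    then show "set_mset n \<inter> S j \<noteq> {}"
      by blast
  qed
  have transversal_iff: "transversal T \<longleftrightarrow> (\<exists>t. T = t ` {..<length as} \<and> (\<forall>j<length as. t j \<in># as ! j))" for T
    unfolding transversal_def by (auto simp: S_def d)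
  have "X_complex I as - Y_complex I as = faces"
  proof -
    have "as ! j \<inter># mset_set A = {#} \<longleftrightarrow> A \<inter> S j = {}" for j A
    proof -
      have "set_mset (as ! j \<inter># mset_set A) = A \<inter> S j"
        by (auto simp: S_def)
      then show ?thesis
        by (metis set_mset_eq_empty_iff)
    qed
    then have Y: "Y_complex I as = {A \<in> X_complex I as. \<exists>j<d. A \<inter> S j = {}}"
      by (simp add: Y_complex_def d)
    have "set as = (!) as ` {..<d}"
      by (auto simp: set_conv_nth d)
    then have "seq_support as = (\<Union>j<d. S j)"
      by (simp add: seq_support_def S_def)
    moreover have "complement_edges I as = {T. transversal T} - clutter_edges I"
      unfolding complement_edges_def transversal_iff by (rule refl)
    ultimately have X: "X_complex I as =
        {A. A \<subseteq> (\<Union>j<d. S j) \<and> (\<forall>T. transversal T \<and> T \<subseteq> A \<longrightarrow> T \<in> clutter_edges I)}"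
      unfolding X_complex_def by auto
    show ?thesis
      unfolding Y X faces_def hits_def by auto
  qed
  then interpret linear_clutter I M d S "clutter_edges I" pos "X_complex I as" "Y_complex I as"
  proof unfold_locales
    show "\<exists>T\<in>clutter_edges I. transversal T \<and> m = mset_set T" if m: "mon m \<in> I" "size m = d" for m
    proof -
      \<comment> \<open>A monomial of \<open>I\<close> of least possible degree is a minimal
        generator, hence squarefree; so its support has \<open>d\<close> elements and, meeting
        \<open>d\<close> disjoint classes, is a transversal.\<close>
      have "n = m" if n: "mon n \<in> I" "n \<subseteq># m" for n
      proof (rule ccontr)
        assume "n \<noteq> m"
        then have "size n < size m"
          using n(2) by (simp add: mset_subset_size subset_mset.less_le)
        then show False
          using initial_degree_le[OF n(1)] m(2) by (simp add: d_def)
      qed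
      then have gen: "m \<in> min_gens I"
        using m(1) by (simp add: min_gens_def)
      then have "card (set_mset m) = d"
        using sqf m(2) by (metis size_mset_set)
      then have "transversal (set_mset m)"
        by (rule hits_card_eq[OF meets[OF m(1)]])
      moreover have "set_mset m \<in> clutter_edges I"
        using gen by (simp add: clutter_edges_def)
      ultimately show ?thesis
        using sqf[OF gen] by metis
    qed
    show "mon (mset_set T) \<in> I" if "T \<in> clutter_edges I" for T
      using that sqf by (auto simp: clutter_edges_def min_gens_def)
  qed
  show ?thesis
    using linear_presentation_isomorphic[OF relative_complex_presentation linear_strand_presentation[folded d_def]]
    unfolding first_linear_strand_eq d_def .
qed

end
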